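(* There exist positive constants $c_1$ and $c_2$ (not depending on $t$ or $q$) such that for all positive integers $t$ and $q$ with $q\ge 2$, there is $n_0=n_0(t,q)$ such that for all $n\ge n_0$, $$c_1\, t\,q^n/\sqrt{n} \le tw(H(t,q,n)) \le c_2\, t\,q^n/\sqrt{n}.$$
   Context: $H(t,q,n)$ (generalized Hamming graph) is the graph with vertex set $\{1,\dots,q\}^n$, two distinct vectors being adjacent iff their Hamming distance (number of coordinates in which they differ) is at most $t$. $tw(G)$ denotes the treewidth of $G$ (minimum over tree decompositions of maximum bag size minus 1). *)

theory Defs
  imports Complex_Main "HOL-Library.FuncSet" "Graph_Theory.Digraph_Component"
begin

text \<open>
  Finite simple graphs are symmetric loop-free finite digraphs (locale \<^locale>\<open>pair_graph\<close>):
  an edge is represented by its two opposite arcs.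

  The predicates \<^const>\<open>forest\<close> and \<^const>\<open>tree\<close> of \<^theory>\<open>Graph_Theory.Digraph_Component\<close>
  speak about directed cycles and so do not fit here: in a symmetric digraph, going along an
  edge and back is already a cycle. A cycle of a simple graph is a cycle of length at least 3.
\<close>

definition undirected_tree :: "'a pair_pre_digraph \<Rightarrow> bool" where
  "undirected_tree T \<longleftrightarrow>
     pair_graph T \<and>
     Digraph_Component.connected (with_proj T) \<and>
     \<not> (\<exists>p. pre_digraph.cycle (with_proj T) p \<and> 3 \<le> length p)"

text \<open>
  Note that \<^const>\<open>Digraph_Component.connected\<close> requires a nonempty vertex set.
\<close>

definition tree_decomposition ::
    "'b pair_pre_digraph \<Rightarrow> ('b \<Rightarrow> 'a set) \<Rightarrow> 'a pair_pre_digraph \<Rightarrow> bool" where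
  "tree_decomposition T B G \<longleftrightarrow>
     undirected_tree T \<and>
     (\<Union>i\<in>pverts T. B i) = pverts G \<and>
     (\<forall>(u, v)\<in>parcs G. \<exists>i\<in>pverts T. u \<in> B i \<and> v \<in> B i) \<and>
     (\<forall>v\<in>pverts G. Digraph_Component.connected (with_proj T \<restriction> {i \<in> pverts T. v \<in> B i}))"

definition decomposition_width :: "'b pair_pre_digraph \<Rightarrow> ('b \<Rightarrow> 'a set) \<Rightarrow> nat" where
  "decomposition_width T B = Max ((\<lambda>i. card (B i)) ` pverts T) - 1"

text \<open>
  Decomposition trees are finite, so taking their nodes to be natural numbers is no restriction.
  The graph without vertices gets treewidth 0 (rather than -1), by truncated subtraction.
\<close>

definition treewidth :: "'a pair_pre_digraph \<Rightarrow> nat" where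
  "treewidth G = (LEAST w. \<exists>(T :: nat pair_pre_digraph) B.
     tree_decomposition T B G \<and> decomposition_width T B = w)"

definition hamming_dist :: "nat \<Rightarrow> (nat \<Rightarrow> nat) \<Rightarrow> (nat \<Rightarrow> nat) \<Rightarrow> nat" where
  "hamming_dist n x y = card {i \<in> {1..n}. x i \<noteq> y i}"

definition hamming_graph :: "nat \<Rightarrow> nat \<Rightarrow> nat \<Rightarrow> (nat \<Rightarrow> nat) pair_pre_digraph" where
  "hamming_graph t q n =
     (let V = {1..n} \<rightarrow>\<^sub>E {1..q} in
      \<lparr> pverts = V,
        parcs = {(x, y). x \<in> V \<and> y \<in> V \<and> x \<noteq> y \<and> hamming_dist n x y \<le> t} \<rparr>)"

lemma pair_graph_hamming_graph: "pair_graph (hamming_graph t q n)"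
proof -
  let ?V = "{1..n} \<rightarrow>\<^sub>E {1..q}"
  have fin: "finite ?V"
    by (intro finite_PiE) auto
  have sub: "parcs (hamming_graph t q n) \<subseteq> ?V \<times> ?V"
    by (auto simp: hamming_graph_def Let_def)
  have "finite (parcs (hamming_graph t q n))"
    using finite_subset[OF sub] fin by blast
  moreover have "hamming_dist n x y = hamming_dist n y x" for x y
    unfolding hamming_dist_def by metis
  ultimately show ?thesis
    using fin by unfold_locales (auto simp: hamming_graph_def Let_def symmetric_def sym_def)
qed

text \<open>
  The minimum defining \<^const>\<open>treewidth\<close> ranges over a nonempty set: a single bag is a decomposition.
\<close>

lemma tree_decomposition_single_bag:
  assumes "pair_graph G"
  shows "tree_decomposition \<lparr> pverts = {0 :: nat}, parcs = {} \<rparr> (\<lambda>_. pverts G) G"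
proof -
  interpret G: pair_graph G by fact
  let ?T = "\<lparr> pverts = {0 :: nat}, parcs = {} \<rparr>"
  have "pair_graph ?T"
    by unfold_locales (auto simp: symmetric_def sym_def)
  moreover have "Digraph_Component.connected (with_proj ?T)"
    by (auto simp: Digraph_Component.connected_def strongly_connected_def mk_symmetric_def
        reachable_def)
  moreover have "\<not> pre_digraph.cycle (with_proj ?T) p" for p
    by (auto simp: pre_digraph.cycle_def pre_digraph.awalk_def)
  ultimately have "undirected_tree ?T"
    by (auto simp: undirected_tree_def)
  moreover have "Digraph_Component.connected (with_proj ?T \<restriction> {0})"
    by (auto simp: Digraph_Component.connected_def strongly_connected_def mk_symmetric_def
        reachable_def)
  ultimately show ?thesis
    by (auto simp: tree_decomposition_def dest: G.in_arcsD1 G.in_arcsD2)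
qed

lemma treewidth_attained:
  assumes "pair_graph G"
  obtains T :: "nat pair_pre_digraph" and B
  where "tree_decomposition T B G" "decomposition_width T B = treewidth G"
proof -
  have "\<exists>w. \<exists>(T :: nat pair_pre_digraph) B.
      tree_decomposition T B G \<and> decomposition_width T B = w"
    using tree_decomposition_single_bag[OF assms] by blast
  from LeastI_ex[OF this] show thesis
    using that unfolding treewidth_def by blast
qed

end

theory Submission
  imports Defs
begin

text \<open>
  Lower bound: a tree decomposition has a bag whose removal splits the graph into two unions of
  components, each of which, together with the bag, contains a third of the vertices. For
  \<open>t = 1\<close>, isoperimetry in \<open>{1..q} ^ n\<close> follows from the functional
  inequality \<open>a (N - a) / (2 N) \<le> (\<Sum>x\<in>A. sqrt (h x))\<close>, where \<open>a = card A\<close>, \<open>N = q ^ n\<close> and \<open>h x\<close> is the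
  number of directions in which one can leave \<open>A\<close> from \<open>x\<close>; unlike the bound on the boundary
  itself, it tensorizes, so it is proved by induction on the number of coordinates. Two sets at distance more
  than \<open>t\<close> are separated by \<open>t\<close> successive boundaries, whence the factor \<open>t\<close>.

  Upper bound: order the vertices by the number of coordinates in \<open>{1..q div 2}\<close>. Adjacent
  vertices differ by at most \<open>t\<close> in this weight, so the unions of \<open>t + 1\<close> consecutive weight layers are
  the bags of a path decomposition, and each layer has size \<open>O(q ^ n / sqrt n)\<close>.
\<close>

subsection \<open>Isoperimetry\<close>

text \<open>Directions are counted, not neighbours outside \<open>A\<close>. The count is therefore
  at most \<open>card I\<close> whatever the size of \<open>Q\<close>, which keeps the final
  constants independent of \<open>q\<close>.\<close>

definition exit_count :: "'i set \<Rightarrow> 'a set \<Rightarrow> ('i \<Rightarrow> 'a) set \<Rightarrow> ('i \<Rightarrow> 'a) \<Rightarrow> nat" where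
  "exit_count I Q A x = card {i \<in> I. \<exists>v\<in>Q. x(i := v) \<notin> A}"

lemma minkowski_sqrt:
  fixes a b :: "'a \<Rightarrow> real"
  shows "sqrt ((\<Sum>x\<in>A. a x)\<^sup>2 + (\<Sum>x\<in>A. b x)\<^sup>2) \<le> (\<Sum>x\<in>A. sqrt ((a x)\<^sup>2 + (b x)\<^sup>2))"
  using norm_sum[of "\<lambda>x. Complex (a x) (b x)" A] by (simp add: cmod_def)

text \<open>Numerical core of the induction step: \<open>F\<close> is the inductive bound for one
  slice, \<open>d\<close> the excess of that slice over the smallest one. With
  \<open>u = d\<^sup>2 / M\<close> the square of the left side is
  \<open>F\<^sup>2 + u * F + u\<^sup>2 / 4\<close>; the last two terms are at most
  \<open>d\<^sup>2 / 8\<close> and \<open>d\<^sup>2 / 4\<close>.\<close>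

lemma sqrt_sum_squares_ge:
  fixes M F d :: real
  assumes "0 < M" "0 \<le> F" "8 * F \<le> M" "0 \<le> d" "d \<le> M" "F \<le> J" "d \<le> D"
  shows "F + d\<^sup>2 / (2 * M) \<le> sqrt (J\<^sup>2 + D\<^sup>2)"
proof -
  define u where "u = d\<^sup>2 / M"
  have u: "0 \<le> u" "u * M = d\<^sup>2" using assms by (auto simp: u_def)
  have "d\<^sup>2 \<le> M * M" using assms by (simp add: power2_eq_square mult_mono)
  then have "u \<le> M" using assms by (simp add: u_def divide_le_eq)
  then have "u * u \<le> d\<^sup>2" using u mult_left_mono[of u M u] by simp
  moreover have "u * (8 * F) \<le> d\<^sup>2" using u assms mult_left_mono[of "8 * F" M u] by simp
  moreover have "(F + u / 2)\<^sup>2 = F\<^sup>2 + u * (8 * F) / 8 + u * u / 4"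
    by (simp add: power2_eq_square algebra_simps)
  moreover have "F\<^sup>2 \<le> J\<^sup>2" "d\<^sup>2 \<le> D\<^sup>2" using assms by (auto intro!: power_mono)
  moreover have "0 \<le> d\<^sup>2" by simp
  ultimately have "(F + u / 2)\<^sup>2 \<le> J\<^sup>2 + D\<^sup>2" by linarith
  then have "F + u / 2 \<le> sqrt (J\<^sup>2 + D\<^sup>2)" by (rule real_le_rsqrt)
  moreover have "u / 2 = d\<^sup>2 / (2 * M)" by (simp add: u_def)
  ultimately show ?thesis by simp
qed

text \<open>The numerator \<open>a v * (M - a v) + (a v - m)\<^sup>2\<close> is linear in
  \<open>a v\<close>, so the right side depends only on the sum \<open>s\<close> of the slice sizes.
  It exceeds the left side by the nonnegative \<open>(q * m - s)\<^sup>2 / (2 * (q * M))\<close>,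
  for every choice of \<open>m\<close>.\<close>

lemma slice_average:
  fixes a :: "'a \<Rightarrow> real" and m M :: real
  assumes "finite Q" "Q \<noteq> {}" "0 < M"
  shows "(\<Sum>v\<in>Q. a v) * (card Q * M - (\<Sum>v\<in>Q. a v)) / (2 * (card Q * M)) \<le>
    (\<Sum>v\<in>Q. a v * (M - a v) / (2 * M) + (a v - m)\<^sup>2 / (2 * M))"
proof -
  define s where "s = (\<Sum>v\<in>Q. a v)"
  define q where "q = real (card Q)"
  have q: "q > 0" using assms by (auto simp: q_def card_gt_0_iff)
  have "(\<Sum>v\<in>Q. a v * (M - a v) / (2 * M) + (a v - m)\<^sup>2 / (2 * M)) =
      (\<Sum>v\<in>Q. (a v * (M - 2 * m) + m\<^sup>2) / (2 * M))"
  proof (rule sum.cong)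
    fix v
    have "a v * (M - a v) + (a v - m)\<^sup>2 = a v * (M - 2 * m) + m\<^sup>2"
      by (simp add: power2_eq_square algebra_simps)
    then show "a v * (M - a v) / (2 * M) + (a v - m)\<^sup>2 / (2 * M) =
        (a v * (M - 2 * m) + m\<^sup>2) / (2 * M)"
      by (simp add: add_divide_distrib[symmetric])
  qed simp
  also have "\<dots> = (s * (M - 2 * m) + q * m\<^sup>2) / (2 * M)"
    by (simp add: sum_divide_distrib[symmetric] sum.distrib sum_distrib_right s_def q_def)
  finally have *: "(\<Sum>v\<in>Q. a v * (M - a v) / (2 * M) + (a v - m)\<^sup>2 / (2 * M)) = \<dots>" .
  have "q * (s * (M - 2 * m) + q * m\<^sup>2) - (q * m - s)\<^sup>2 = s * (q * M - s)"
    by (simp add: power2_eq_square algebra_simps)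
  moreover have "(s * (M - 2 * m) + q * m\<^sup>2) / (2 * M) =
      (q * (s * (M - 2 * m) + q * m\<^sup>2)) / (2 * (q * M))"
    using q by simp
  ultimately have "s * (q * M - s) / (2 * (q * M)) = (s * (M - 2 * m) + q * m\<^sup>2) / (2 * M)
      - (q * m - s)\<^sup>2 / (2 * (q * M))"
    by (simp only: diff_divide_distrib[symmetric])
  moreover have "0 \<le> (q * m - s)\<^sup>2 / (2 * (q * M))" using q assms by simp
  ultimately show ?thesis
    unfolding * s_def[symmetric] q_def[symmetric] by linarith
qed

lemma PiE_const_fun_upd:
  assumes "x \<in> PiE I (\<lambda>_. Q)" "i \<in> I" "v \<in> Q"
  shows "x(i := v) \<in> PiE I (\<lambda>_. Q)"
  using PiE_fun_upd[of v "\<lambda>_. Q" i, OF assms(3,1)] by (simp only: insert_absorb[OF assms(2)])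

text \<open>\<open>B w\<close> is the slice of \<open>A\<close> at value \<open>w\<close> of
  coordinate \<open>i\<close>. Changing a coordinate in \<open>J\<close> stays inside the slice at
  \<open>v\<close>, while changing coordinate \<open>i\<close> carries the same \<open>x\<close> to
  another slice.\<close>

lemma exit_count_insert:
  assumes i: "i \<notin> J" and J: "finite J" and x: "x \<in> PiE J (\<lambda>_. Q)" and v: "v \<in> Q"
    and B: "\<And>w. B w = {x \<in> PiE J (\<lambda>_. Q). x(i := w) \<in> A}"
  shows "exit_count (insert i J) Q A (x(i := v)) =
    exit_count J Q (B v) x + (if \<exists>w\<in>Q. x \<notin> B w then 1 else 0)"
proof -
  have "(x(i := v))(j := w) \<notin> A \<longleftrightarrow> x(j := w) \<notin> B v" if "j \<in> J" "w \<in> Q" for j w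
  proof -
    have "i \<noteq> j" using i that by blast
    then have "(x(i := v))(j := w) = (x(j := w))(i := v)" by (rule fun_upd_twist)
    then show ?thesis using PiE_const_fun_upd[OF x that] by (simp only: B mem_Collect_eq simp_thms)
  qed
  then have 1: "{j \<in> J. \<exists>w\<in>Q. (x(i := v))(j := w) \<notin> A} = {j \<in> J. \<exists>w\<in>Q. x(j := w) \<notin> B v}"
    by blast
  have 2: "(\<exists>w\<in>Q. (x(i := v))(i := w) \<notin> A) \<longleftrightarrow> (\<exists>w\<in>Q. x \<notin> B w)"
    using x by (simp only: B mem_Collect_eq simp_thms fun_upd_upd)
  show ?thesis
  proof (cases "\<exists>w\<in>Q. x \<notin> B w")
    case True
    then have "{j \<in> insert i J. \<exists>w\<in>Q. (x(i := v))(j := w) \<notin> A} =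
        insert i {j \<in> J. \<exists>w\<in>Q. x(j := w) \<notin> B v}"
      using 1 2 by blast
    then show ?thesis using True i J unfolding exit_count_def by (simp del: fun_upd_apply)
  next
    case False
    then have "{j \<in> insert i J. \<exists>w\<in>Q. (x(i := v))(j := w) \<notin> A} =
        {j \<in> J. \<exists>w\<in>Q. x(j := w) \<notin> B v}"
      using 1 2 by blast
    then show ?thesis using False unfolding exit_count_def by simp
  qed
qed

lemma bij_betw_slices:
  assumes i: "i \<notin> J" and A: "A \<subseteq> PiE (insert i J) (\<lambda>_. Q)"
  shows "bij_betw (\<lambda>(v, x). x(i := v)) (SIGMA v:Q. {x \<in> PiE J (\<lambda>_. Q). x(i := v) \<in> A}) A"
    (is "bij_betw ?f ?S A")
  unfolding bij_betw_def
proof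
  show "inj_on ?f ?S"
  proof (rule inj_onI)
    fix z z' assume z: "z \<in> ?S" "z' \<in> ?S" and f: "?f z = ?f z'"
    obtain v x where zv: "z = (v, x)" by (cases z)
    obtain w y where zw: "z' = (w, y)" by (cases z')
    have e: "x(i := v) = y(i := w)" using f by (simp only: zv zw prod.case)
    have "x \<in> PiE J (\<lambda>_. Q)" "y \<in> PiE J (\<lambda>_. Q)" using z by (simp_all only: zv zw mem_Sigma_iff mem_Collect_eq)
    \<comment> \<open>Both values are \<open>undefined\<close>, the default of extensional functions
      outside \<open>J\<close>; hence overwriting coordinate \<open>i\<close> loses no
      information.\<close>
    then have *: "x i = y i" using i PiE_arb[of x J _ i] PiE_arb[of y J _ i] by simp
    from fun_cong[OF e, of i] have "v = w" by simp
    moreover have "x = y"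
    proof -
      have "x = (x(i := v))(i := x i)" by simp
      also have "\<dots> = (y(i := w))(i := y i)" by (simp only: e *)
      also have "\<dots> = y" by simp
      finally show ?thesis .
    qed
    ultimately show "z = z'" by (simp only: zv zw)
  qed
  show "?f ` ?S = A"
  proof
    show "?f ` ?S \<subseteq> A" by (rule image_subsetI, erule SigmaE) simp
    show "A \<subseteq> ?f ` ?S"
    proof
      fix x assume x: "x \<in> A"
      then have xi: "x \<in> PiE (insert i J) (\<lambda>_. Q)" using A by blast
      then have "x i \<in> Q" by (rule PiE_mem) simp
      moreover have "x(i := undefined) \<in> PiE J (\<lambda>_. Q)" using fun_upd_in_PiE[OF i xi] .
      moreover have "x = ?f (x i, x(i := undefined))" by simp
      ultimately show "x \<in> ?f ` ?S"
        using x by (intro image_eqI[of _ _ "(x i, x(i := undefined))"] SigmaI CollectI conjI)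
          (simp_all del: fun_upd_apply)
    qed
  qed
qed

text \<open>Induction on the coordinates. Within each slice, the induction hypothesis handles the
  old directions and the excess over the smallest slice handles the new one;
  \<open>minkowski_sqrt\<close> merges the two under the square root, and
  \<open>slice_average\<close> sums over the slices.\<close>

lemma sum_sqrt_exit_count_ge:
  fixes A :: "('i \<Rightarrow> 'a) set"
  assumes "finite I" "finite Q" "Q \<noteq> {}" "A \<subseteq> PiE I (\<lambda>_. Q)"
  shows "real (card A) * (real (card Q) ^ card I - real (card A)) / (2 * real (card Q) ^ card I)
    \<le> (\<Sum>x\<in>A. sqrt (real (exit_count I Q A x)))"
  using assms(1,4)
proof (induction I arbitrary: A rule: finite_induct)
  case empty
  \<comment> \<open>With no coordinates there is a single point, so \<open>N = 1\<close> and
    \<open>a * (N - a) = 0\<close>.\<close>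
  then have "A = {} \<or> A = {\<lambda>_. undefined}" by (auto simp: subset_singleton_iff)
  then show ?case by (auto simp: sum_nonneg)
next
  case (insert i J)
  define q where "q = card Q"
  define M where "M = real q ^ card J"
  define B where "B v = {x \<in> PiE J (\<lambda>_. Q). x(i := v) \<in> A}" for v
  define b where "b v = real (card (B v))" for v
  have finPi: "finite (PiE J (\<lambda>_. Q))" using insert assms by (intro finite_PiE) auto
  have finB: "finite (B v)" for v using finPi by (auto simp: B_def)
  have q: "q > 0" using assms by (auto simp: q_def card_gt_0_iff)
  have M: "M > 0" using q by (simp add: M_def)
  have bM: "b v \<le> M" for v
  proof -
    have "card (B v) \<le> card (PiE J (\<lambda>_. Q))" using finPi by (intro card_mono) (auto simp: B_def)
    also have "\<dots> = q ^ card J" using insert by (simp add: card_PiE q_def)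
    finally show ?thesis by (simp add: b_def M_def flip: of_nat_power)
  qed
  have bij: "bij_betw (\<lambda>(v, x). x(i := v)) (SIGMA v:Q. B v) A"
    unfolding B_def by (rule bij_betw_slices) (use insert in auto)
  have "card A = (\<Sum>v\<in>Q. card (B v))"
    using bij_betw_same_card[OF bij] finB assms by simp
  then have cardA: "real (card A) = (\<Sum>v\<in>Q. b v)" by (simp add: b_def)
  \<comment> \<open>The smallest slice \<open>B w\<close> serves as reference: each point of
    \<open>B v\<close> missing from \<open>B w\<close> gives a point of \<open>A\<close> that can be
    left in direction \<open>i\<close>.\<close>
  have "Min (b ` Q) \<in> b ` Q" using assms by (intro Min_in) auto
  then obtain w where w: "w \<in> Q" "b w = Min (b ` Q)" by fastforce
  have wmin: "b w \<le> b v" if "v \<in> Q" for v using that w assms by auto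
  have slice: "b v * (M - b v) / (2 * M) + (b v - b w)\<^sup>2 / (2 * M) \<le>
      (\<Sum>x\<in>B v. sqrt (real (exit_count (insert i J) Q A (x(i := v)))))" if v: "v \<in> Q" for v
  proof -
    define d where "d x = (if \<exists>w\<in>Q. x \<notin> B w then 1 else 0 :: real)" for x
    have IH: "b v * (M - b v) / (2 * M) \<le> (\<Sum>x\<in>B v. sqrt (real (exit_count J Q (B v) x)))"
      using insert.IH[of "B v"] by (auto simp: B_def b_def M_def q_def)
    have "b v - b w \<le> (\<Sum>x\<in>B v. d x)"
    proof -
      have "card (B v) - card (B w) \<le> card (B v - B w)"
        using finB diff_card_le_card_Diff by blast
      then have "b v - b w \<le> card (B v - B w)" by (simp add: b_def)
      also have "\<dots> = (\<Sum>x\<in>B v. if x \<notin> B w then 1 else 0)"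
        using finB by (simp add: sum.If_cases Diff_eq Compl_eq)
      also have "\<dots> \<le> (\<Sum>x\<in>B v. d x)" using w by (intro sum_mono) (auto simp: d_def)
      finally show ?thesis .
    qed
    \<comment> \<open>By AM-GM, \<open>b v * (M - b v)\<close> is at most
      \<open>M\<^sup>2 / 4\<close>.\<close>
    moreover have "8 * (b v * (M - b v) / (2 * M)) \<le> M"
    proof -
      have "0 \<le> (M - 2 * b v)\<^sup>2" by simp
      then have "4 * (b v * (M - b v)) \<le> M * M" by (simp add: power2_eq_square algebra_simps)
      then show ?thesis using M by (simp add: field_simps)
    qed
    moreover have "0 \<le> b v * (M - b v) / (2 * M)" using M bM[of v] by (simp add: b_def)
    moreover have "b v - b w \<le> M" using bM[of v] by (simp add: b_def)
    ultimately have "b v * (M - b v) / (2 * M) + (b v - b w)\<^sup>2 / (2 * M) \<le>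
       sqrt ((\<Sum>x\<in>B v. sqrt (real (exit_count J Q (B v) x)))\<^sup>2 + (\<Sum>x\<in>B v. d x)\<^sup>2)"
      using sqrt_sum_squares_ge[OF M] IH wmin[OF v] by auto
    also have "\<dots> \<le> (\<Sum>x\<in>B v. sqrt ((sqrt (real (exit_count J Q (B v) x)))\<^sup>2 + (d x)\<^sup>2))"
      by (rule minkowski_sqrt)
    also have "\<dots> = (\<Sum>x\<in>B v. sqrt (real (exit_count (insert i J) Q A (x(i := v)))))"
    proof (rule sum.cong)
      fix x assume "x \<in> B v"
      then show "sqrt ((sqrt (real (exit_count J Q (B v) x)))\<^sup>2 + (d x)\<^sup>2) =
          sqrt (real (exit_count (insert i J) Q A (x(i := v))))"
        using v insert by (subst exit_count_insert[where B = B])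
          (auto simp: B_def d_def)
    qed simp
    finally show ?thesis .
  qed
  have N: "real (card Q) ^ card (insert i J) = real (card Q) * M"
    using insert by (simp add: M_def q_def)
  have "real (card A) * (real (card Q) ^ card (insert i J) - real (card A)) /
        (2 * real (card Q) ^ card (insert i J)) \<le>
      (\<Sum>v\<in>Q. b v * (M - b v) / (2 * M) + (b v - b w)\<^sup>2 / (2 * M))"
    unfolding N cardA using slice_average[of Q M b "b w"] assms M by simp
  also have "\<dots> \<le> (\<Sum>v\<in>Q. \<Sum>x\<in>B v. sqrt (real (exit_count (insert i J) Q A (x(i := v)))))"
    by (rule sum_mono) (rule slice)
  also have "\<dots> = (\<Sum>(v, x)\<in>(SIGMA v:Q. B v). sqrt (real (exit_count (insert i J) Q A (x(i := v)))))"
    using finB assms by (subst sum.Sigma) auto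
  also have "\<dots> = (\<Sum>x\<in>A. sqrt (real (exit_count (insert i J) Q A x)))"
    by (subst sum.reindex_bij_betw[OF bij, symmetric]) (auto intro!: sum.cong)
  finally show ?case .
qed

text \<open>The functional inequality is applied to the complement of \<open>A\<close>, which leaves
  \<open>a * (N - a)\<close> unchanged. Only outer boundary points have a positive exit count there,
  and each contributes at most \<open>sqrt (card I)\<close>.\<close>

lemma outer_boundary_ge:
  assumes "finite I" "finite Q" "Q \<noteq> {}" "A \<subseteq> PiE I (\<lambda>_. Q)"
  defines "N \<equiv> real (card Q) ^ card I"
  shows "real (card A) * (N - real (card A)) / (2 * N) \<le>
    sqrt (real (card I)) *
      real (card {y \<in> PiE I (\<lambda>_. Q) - A. \<exists>i\<in>I. \<exists>v\<in>Q. y(i := v) \<in> A})"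
proof -
  let ?V = "PiE I (\<lambda>_. Q)"
  define D where "D = {y \<in> ?V - A. \<exists>i\<in>I. \<exists>v\<in>Q. y(i := v) \<in> A}"
  have fin: "finite ?V" using assms by (intro finite_PiE) auto
  have "card ?V = card Q ^ card I" using assms by (simp add: card_PiE)
  then have cV: "real (card ?V) = N" by (simp add: N_def)
  have "card (?V - A) = card ?V - card A" "card A \<le> card ?V"
    using fin assms by (auto simp: card_Diff_subset finite_subset intro: card_mono)
  then have c: "real (card (?V - A)) = N - real (card A)" using cV by simp
  have "real (card A) * (N - real (card A)) / (2 * N) \<le>
      (\<Sum>x\<in>?V - A. sqrt (real (exit_count I Q (?V - A) x)))"
    using sum_sqrt_exit_count_ge[OF assms(1-3), of "?V - A"] c
    by (simp add: N_def[symmetric] mult.commute)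
  also have "\<dots> \<le> (\<Sum>x\<in>?V - A. if x \<in> D then sqrt (real (card I)) else 0)"
  proof (rule sum_mono)
    fix x assume x: "x \<in> ?V - A"
    have upd: "x(i := v) \<in> ?V" if "i \<in> I" "v \<in> Q" for i v
      using x that by (intro PiE_const_fun_upd) auto
    show "sqrt (real (exit_count I Q (?V - A) x)) \<le> (if x \<in> D then sqrt (real (card I)) else 0)"
    proof (cases "x \<in> D")
      case True
      have "exit_count I Q (?V - A) x \<le> card I"
        unfolding exit_count_def using assms by (intro card_mono) auto
      then show ?thesis using True by simp
    next
      case False
      then have "{i \<in> I. \<exists>v\<in>Q. x(i := v) \<notin> ?V - A} = {}"
        using x upd by (auto simp: D_def)
      then have "exit_count I Q (?V - A) x = 0" by (simp only: exit_count_def card.empty)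
      then show ?thesis using False by simp
    qed
  qed
  also have "\<dots> = sqrt (real (card I)) * real (card D)"
  proof -
    have "(?V - A) \<inter> {x. x \<in> D} = D" by (auto simp: D_def)
    then show ?thesis using fin by (simp add: sum.If_cases)
  qed
  finally show ?thesis by (simp add: D_def)
qed

section \<open>Sets at Hamming distance more than \<open>t\<close>\<close>

lemma hamming_dist_fun_upd_le:
  "hamming_dist n x (y(i := v)) \<le> Suc (hamming_dist n x y)"
proof -
  have "{j \<in> {1..n}. x j \<noteq> (y(i := v)) j} \<subseteq> insert i {j \<in> {1..n}. x j \<noteq> y j}" by auto
  then have "hamming_dist n x (y(i := v)) \<le> card (insert i {j \<in> {1..n}. x j \<noteq> y j})"
    unfolding hamming_dist_def by (intro card_mono) auto
  also have "\<dots> \<le> Suc (hamming_dist n x y)"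
    unfolding hamming_dist_def by (simp add: card_insert_if)
  finally show ?thesis .
qed

text \<open>The neighbourhoods \<open>E k\<close> of \<open>A\<close> stay disjoint from
  \<open>C\<close> for \<open>k \<le> t\<close>, and each of the \<open>t\<close> steps from
  \<open>E k\<close> to \<open>E (Suc k)\<close> adds an outer boundary of size at least
  \<open>g\<close>.\<close>

lemma hamming_separation:
  assumes "n \<ge> 1" "q \<ge> 1" "A \<subseteq> {1..n} \<rightarrow>\<^sub>E {1..q}" "C \<subseteq> {1..n} \<rightarrow>\<^sub>E {1..q}"
    and far: "\<And>x y. x \<in> A \<Longrightarrow> y \<in> C \<Longrightarrow> t < hamming_dist n x y"
  shows "real (card A) + real (card C) +
      real t * (real (card A) * real (card C) / (2 * real q ^ n * sqrt (real n))) \<le> real q ^ n"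
proof -
  let ?V = "{1..n} \<rightarrow>\<^sub>E {1..q}"
  define g where "g = real (card A) * real (card C) / (2 * real q ^ n * sqrt (real n))"
  define E where "E k = {y \<in> ?V. \<exists>x\<in>A. hamming_dist n x y \<le> k}" for k
  have fin: "finite ?V" by (intro finite_PiE) auto
  have "card ?V = q ^ n" by (simp add: card_PiE)
  then have cV: "real (card ?V) = real q ^ n" by simp
  have EV: "E k \<subseteq> ?V" for k unfolding E_def by blast
  then have finE: "finite (E k)" for k using fin finite_subset by blast
  have refl: "hamming_dist n x x = 0" for x by (simp add: hamming_dist_def)
  have AE: "A \<subseteq> E k" for k
  proof
    fix x assume "x \<in> A"
    then show "x \<in> E k" using assms(3) refl[of x] unfolding E_def by (intro CollectI conjI bexI[of _ x]) auto
  qed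
  have EC: "real (card (E k)) + real (card C) \<le> real q ^ n" if "k \<le> t" for k
  proof -
    have "E k \<inter> C = {}" using far that unfolding E_def by fastforce
    then have "card (E k) + card C = card (E k \<union> C)"
      using finE fin assms by (metis card_Un_disjoint finite_subset)
    also have "\<dots> \<le> card ?V" using fin EV assms by (intro card_mono) blast+
    finally show ?thesis using cV by linarith
  qed
  have "real (card A) + real k * g \<le> real (card (E k))" if "k \<le> t" for k
    using that
  proof (induction k)
    case 0
    then show ?case using card_mono[OF finE AE, of 0] by simp
  next
    case (Suc k)
    define D where "D = {y \<in> ?V - E k. \<exists>i\<in>{1..n}. \<exists>v\<in>{1..q}. y(i := v) \<in> E k}"
    have "D \<subseteq> E (Suc k)"
    proof
      fix y assume "y \<in> D"
      then obtain i v x where y: "y \<in> ?V" "x \<in> A" "hamming_dist n x (y(i := v)) \<le> k"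
        unfolding D_def E_def by blast
      have "hamming_dist n x ((y(i := v))(i := y i)) \<le> Suc k"
        using hamming_dist_fun_upd_le[of n x "y(i := v)" i "y i"] y by linarith
      then show "y \<in> E (Suc k)" using y unfolding E_def fun_upd_upd fun_upd_triv by blast
    qed
    moreover have "E k \<subseteq> E (Suc k)" unfolding E_def by (blast intro: le_SucI)
    ultimately have "card (E k \<union> D) \<le> card (E (Suc k))" using finE by (intro card_mono) auto
    moreover have "card (E k \<union> D) = card (E k) + card D"
      using fin finE finite_subset[of D ?V] by (intro card_Un_disjoint) (blast | simp add: D_def)+
    ultimately have 1: "real (card (E k)) + real (card D) \<le> real (card (E (Suc k)))" by simp
    have "real (card (E k)) * (real q ^ n - real (card (E k))) / (2 * real q ^ n) \<le>
      sqrt (real n) * real (card D)"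
      using outer_boundary_ge[of "{1..n}" "{1..q}" "E k"] assms EV[of k] unfolding D_def by simp
    \<comment> \<open>\<open>E k\<close> contains \<open>A\<close> and its complement contains
      \<open>C\<close>, so the same lower bound serves at every step.\<close>
    moreover have "real (card A) * real (card C) / (2 * real q ^ n) \<le>
      real (card (E k)) * (real q ^ n - real (card (E k))) / (2 * real q ^ n)"
      using EC[of k] Suc.prems card_mono[OF finE AE, of k] assms
      by (intro divide_right_mono mult_mono) auto
    ultimately have "g \<le> real (card D)"
      using assms by (simp add: g_def field_simps)
    then show ?case using 1 Suc by (simp add: algebra_simps)
  qed
  from this[of t] EC[of t] show ?thesis by (simp add: g_def)
qed

subsection \<open>Size of the weight layers\<close>

text \<open>Squared to avoid roots in the induction. The ratio of consecutive central binomials is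
  \<open>2 * (2 * k + 1) / (k + 1)\<close>, and
  \<open>(2 * k + 1) * (2 * k + 3) \<le> 4 * (k + 1)\<^sup>2\<close> closes the step.\<close>

lemma central_binomial_sq_le: "real ((2 * k) choose k) ^ 2 * (2 * real k + 1) \<le> 16 ^ k"
proof (induction k)
  case (Suc k)
  define c where "c = real ((2 * k) choose k)"
  define d where "d = real ((2 * Suc k) choose Suc k)"
  have "Suc k * ((2 * Suc k) choose Suc k) = (2 * Suc k) * ((2 * k + 1) choose k)"
    using Suc_times_binomial[of k "2 * k + 1"] by simp
  then have "Suc k * ((2 * Suc k) choose Suc k) = Suc k * (2 * ((2 * k + 1) choose k))"
    by simp
  then have 1: "(2 * Suc k) choose Suc k = 2 * ((2 * k + 1) choose k)"
    by (metis mult_cancel1 nat.simps(3))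
  have "(2 * k + 1) choose k = (2 * k + 1) choose Suc k"
    by (subst binomial_symmetric) auto
  moreover have "Suc k * ((2 * k + 1) choose Suc k) = (2 * k + 1) * ((2 * k) choose k)"
    using Suc_times_binomial[of k "2 * k"] by simp
  ultimately have "Suc k * ((2 * Suc k) choose Suc k) = 2 * ((2 * k + 1) * ((2 * k) choose k))"
    unfolding 1 by (simp only: mult.left_commute[of "Suc k" 2])
  then have "real (Suc k * ((2 * Suc k) choose Suc k)) = real (2 * ((2 * k + 1) * ((2 * k) choose k)))"
    by (rule arg_cong)
  then have rec: "(real k + 1) * d = 2 * (2 * real k + 1) * c"
    unfolding c_def d_def of_nat_mult by (simp add: add.commute)
  have "(real k + 1)\<^sup>2 * (d\<^sup>2 * (2 * real k + 3)) = ((real k + 1) * d)\<^sup>2 * (2 * real k + 3)"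
    by (simp add: power_mult_distrib)
  also have "\<dots> = 4 * ((2 * real k + 1) * (2 * real k + 3)) * (c\<^sup>2 * (2 * real k + 1))"
    unfolding rec by (simp add: power2_eq_square algebra_simps)
  also have "\<dots> \<le> 4 * (4 * (real k + 1)\<^sup>2) * 16 ^ k"
  proof (rule mult_mono)
    show "4 * ((2 * real k + 1) * (2 * real k + 3)) \<le> 4 * (4 * (real k + 1)\<^sup>2)"
      by (simp add: power2_eq_square algebra_simps)
    show "c\<^sup>2 * (2 * real k + 1) \<le> 16 ^ k" using Suc by (simp add: c_def)
  qed auto
  also have "\<dots> = (real k + 1)\<^sup>2 * 16 ^ Suc k" by simp
  finally have "d\<^sup>2 * (2 * real k + 3) \<le> 16 ^ Suc k"
    by (rule mult_left_le_imp_le) auto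
  then show ?case by (simp add: d_def algebra_simps)
qed simp

lemma central_binomial_le: "real ((2 * k) choose k) * sqrt (2 * real k + 1) \<le> 4 ^ k"
proof -
  have "(4 ^ k)\<^sup>2 = (16 :: real) ^ k"
    by (simp add: power2_eq_square flip: power_mult_distrib)
  moreover have "(real ((2 * k) choose k) * sqrt (2 * real k + 1))\<^sup>2 =
      (real ((2 * k) choose k))\<^sup>2 * (2 * real k + 1)"
    by (simp add: power_mult_distrib)
  ultimately have "(real ((2 * k) choose k) * sqrt (2 * real k + 1))\<^sup>2 \<le> (4 ^ k)\<^sup>2"
    using central_binomial_sq_le[of k] by simp
  then show ?thesis by (rule power2_le_imp_le) simp
qed

text \<open>The middle coefficient is the largest. For odd \<open>m = 2 * k + 1\<close> it is half
  of the central coefficient of \<open>2 * k + 2\<close>, which reduces to the even case.\<close>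

lemma choose_mult_sqrt_le: "real (m choose j) * sqrt (real m + 1) \<le> 2 ^ m"
proof -
  have "m choose j \<le> m choose (m div 2)" by (rule binomial_maximum)
  then have "real (m choose j) * sqrt (real m + 1) \<le> real (m choose (m div 2)) * sqrt (real m + 1)"
    by (intro mult_right_mono) auto
  also have "\<dots> \<le> 2 ^ m"
  proof (cases "even m")
    case True
    then obtain k where m: "m = 2 * k" by auto
    then show ?thesis using central_binomial_le[of k] by (simp add: power_mult)
  next
    case False
    then obtain k where m: "m = 2 * k + 1" using oddE by blast
    have "(2 * k + 1) choose k = (2 * k + 1) choose Suc k"
      by (subst binomial_symmetric) auto
    then have "2 * ((2 * k + 1) choose k) = (2 * Suc k) choose Suc k" by simp
    then have "2 * real ((2 * k + 1) choose k) = real ((2 * Suc k) choose Suc k)"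
      by (metis of_nat_mult of_nat_numeral)
    then have "2 * (real ((2 * k + 1) choose k) * sqrt (real m + 1)) =
        real ((2 * Suc k) choose Suc k) * sqrt (real m + 1)" by simp
    also have "\<dots> \<le> real ((2 * Suc k) choose Suc k) * sqrt (2 * real (Suc k) + 1)"
      by (intro mult_left_mono) (auto simp: m)
    also have "\<dots> \<le> 4 ^ Suc k" by (rule central_binomial_le)
    also have "\<dots> = 2 * 2 ^ m" by (simp add: m power_mult power_add)
    finally show ?thesis using m by simp
  qed
  finally show ?thesis .
qed

text \<open>After division by \<open>(b + 1) ^ n\<close> this bounds the expectation of
  \<open>1 / (m + 1)\<close> for a binomial variable \<open>m = n - j\<close>. Absorbing the
  denominator turns \<open>n choose j\<close> into \<open>Suc n choose j\<close>; what remains is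
  the expansion of \<open>(b + 1) ^ Suc n\<close> without its last term.\<close>

lemma sum_binomial_div_Suc_le:
  fixes b :: real
  assumes "b > 0"
  shows "(\<Sum>j\<le>n. real (n choose j) * b ^ (n - j) / (real (n - j) + 1)) \<le>
    (b + 1) ^ Suc n / (b * (real n + 1))"
proof -
  have "real (n choose j) * b ^ (n - j) / (real (n - j) + 1) =
      real (Suc n choose j) * b ^ (Suc n - j) / (b * (real n + 1))" if "j \<le> n" for j
  proof -
    have "Suc (n - j) * (Suc n choose Suc (n - j)) = Suc n * (n choose (n - j))"
      by (rule Suc_times_binomial)
    moreover have "Suc n choose Suc (n - j) = Suc n choose j"
      using that by (subst binomial_symmetric) (auto simp: Suc_diff_le)
    moreover have "n choose (n - j) = n choose j"
      using that binomial_symmetric by metis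
    ultimately have "real (Suc (n - j) * (Suc n choose j)) = real (Suc n * (n choose j))"
      by (simp only:)
    then have "(real (n - j) + 1) * real (Suc n choose j) = (real n + 1) * real (n choose j)"
      unfolding of_nat_mult by (simp only: of_nat_Suc add.commute)
    moreover have "b ^ (Suc n - j) = b * b ^ (n - j)" using that by (simp add: Suc_diff_le)
    moreover have "real (n - j) + 1 > 0" "real n + 1 > 0" by linarith+
    ultimately show ?thesis using assms by (simp add: frac_eq_eq mult.commute)
  qed
  then have "(\<Sum>j\<le>n. real (n choose j) * b ^ (n - j) / (real (n - j) + 1)) =
      (\<Sum>j\<le>n. real (Suc n choose j) * b ^ (Suc n - j) / (b * (real n + 1)))"
    by (intro sum.cong) auto
  also have "\<dots> \<le> (\<Sum>j\<le>Suc n. real (Suc n choose j) * b ^ (Suc n - j) / (b * (real n + 1)))"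
    using assms by (intro sum_mono2) auto
  also have "\<dots> = (\<Sum>j\<le>Suc n. real (Suc n choose j) * b ^ (Suc n - j)) / (b * (real n + 1))"
    by (simp only: sum_divide_distrib)
  also have "(\<Sum>j\<le>Suc n. real (Suc n choose j) * b ^ (Suc n - j)) = (b + 1) ^ Suc n"
    using binomial_ring[of 1 b "Suc n"] by (simp add: add.commute del: binomial_Suc_Suc)
  finally show ?thesis .
qed

text \<open>AM-GM for \<open>y / x\<^sup>2\<close> and \<open>1 / y\<close>, whose geometric mean is
  \<open>1 / x\<close>. It replaces an average of \<open>1 / sqrt (m + 1)\<close> by one of
  \<open>1 / (m + 1)\<close>, which has a closed bound.\<close>

lemma inverse_sqrt_le:
  fixes m n :: real
  assumes "m \<ge> 0" "n \<ge> 0"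
  shows "1 / sqrt (m + 1) \<le> (sqrt (n + 1) / (m + 1) + 1 / sqrt (n + 1)) / 2"
proof -
  define x y where "x = sqrt (m + 1)" and "y = sqrt (n + 1)"
  have xy: "x > 0" "y > 0" "x\<^sup>2 = m + 1" using assms by (auto simp: x_def y_def)
  have "0 \<le> (y - x)\<^sup>2 / (2 * (x\<^sup>2 * y))" using xy(2) by simp
  also have "\<dots> = (y / x\<^sup>2 + 1 / y) / 2 - 1 / x"
    using xy(1,2) by (simp add: field_simps power2_eq_square)
  finally have "1 / x \<le> (y / x\<^sup>2 + 1 / y) / 2" by simp
  then show ?thesis by (simp only: xy(3)) (simp only: x_def y_def)
qed

text \<open>Here \<open>h\<close> and \<open>e\<close> are the quotient and remainder of
  \<open>q\<close> by 2. For \<open>e = 0\<close> this is the binomial bound. For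
  \<open>e = 1\<close>, sum over the number \<open>j\<close> of coordinates taking the one extra
  value: the other \<open>n - j\<close> coordinates split evenly, which costs a factor
  \<open>1 / sqrt (n - j + 1)\<close>, and this factor is averaged over the binomially distributed
  \<open>j\<close>.\<close>

lemma layer_size_le:
  fixes h e :: nat
  assumes "e \<le> 1" "1 \<le> h"
  shows "real (n choose k) * real h ^ k * real (h + e) ^ (n - k) \<le>
    5 / 4 * real (2 * h + e) ^ n / sqrt (real n + 1)"
proof (cases "k \<le> n")
  case False
  then show ?thesis by (simp add: binomial_eq_0)
next
  case kn: True
  show ?thesis
  proof (cases "e = 0")
    case True
    have "real (n choose k) * real h ^ k * real (h + e) ^ (n - k) = real (n choose k) * real h ^ n"
      using True kn by (simp flip: power_add)
    also have "\<dots> \<le> (2 ^ n / sqrt (real n + 1)) * real h ^ n"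
      using choose_mult_sqrt_le[of n k] by (intro mult_right_mono) (simp_all add: pos_le_divide_eq)
    also have "\<dots> = real (2 * h + e) ^ n / sqrt (real n + 1)"
      using True by (simp add: power_mult_distrib)
    also have "\<dots> \<le> 5 / 4 * real (2 * h + e) ^ n / sqrt (real n + 1)"
      by (intro divide_right_mono) auto
    finally show ?thesis .
  next
    case False
    then have e: "e = 1" using assms by simp
    define b where "b = 2 * real h"
    have b: "b \<ge> 2" using assms by (simp add: b_def)
    have "real (n choose k) * real h ^ k * real (h + e) ^ (n - k) =
        real (n choose k) * real h ^ k * (\<Sum>j\<le>n - k. real (n - k choose j) * real h ^ (n - k - j))"
      using binomial_ring[of 1 "real h" "n - k"] by (simp add: e add.commute)
    also have "\<dots> = (\<Sum>j\<le>n - k. real ((n choose k) * (n - k choose j)) * (real h ^ k * real h ^ (n - k - j)))"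
      by (simp add: sum_distrib_left algebra_simps)
    also have "\<dots> \<le> (\<Sum>j\<le>n - k. real (n choose j) * b ^ (n - j) / sqrt (real (n - j) + 1))"
    proof (rule sum_mono)
      fix j assume j: "j \<in> {..n - k}"
      \<comment> \<open>Both sides count pairs of disjoint subsets of sizes \<open>k\<close> and
        \<open>j\<close>.\<close>
      have "(n choose k) * (n - k choose j) = (n choose j) * (n - j choose k)"
      proof -
        have "(n choose (k + j)) * (k + j choose k) = (n choose k) * (n - k choose j)"
          using choose_mult[of k "k + j" n] j kn by simp
        moreover have "(n choose (k + j)) * (k + j choose j) = (n choose j) * (n - j choose k)"
          using choose_mult[of j "k + j" n] j kn by simp
        moreover have "k + j choose k = k + j choose j"
          by (subst binomial_symmetric) auto
        ultimately show ?thesis by simp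
      qed
      moreover have "real h ^ k * real h ^ (n - k - j) = real h ^ (n - j)"
        using j kn by (simp flip: power_add)
      ultimately have "real ((n choose k) * (n - k choose j)) * (real h ^ k * real h ^ (n - k - j)) =
          real (n choose j) * real (n - j choose k) * real h ^ (n - j)" by simp
      also have "\<dots> \<le> real (n choose j) * (2 ^ (n - j) / sqrt (real (n - j) + 1)) * real h ^ (n - j)"
        using choose_mult_sqrt_le[of "n - j" k]
        by (intro mult_right_mono mult_left_mono) (simp_all add: pos_le_divide_eq)
      also have "\<dots> = real (n choose j) * b ^ (n - j) / sqrt (real (n - j) + 1)"
        by (simp add: b_def power_mult_distrib)
      finally show "real ((n choose k) * (n - k choose j)) * (real h ^ k * real h ^ (n - k - j)) \<le>
          real (n choose j) * b ^ (n - j) / sqrt (real (n - j) + 1)" .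
    qed
    also have "\<dots> \<le> (\<Sum>j\<le>n. real (n choose j) * b ^ (n - j) / sqrt (real (n - j) + 1))"
      using b by (intro sum_mono2) auto
    also have "\<dots> \<le> (\<Sum>j\<le>n. sqrt (real n + 1) / 2 *
          (real (n choose j) * b ^ (n - j) / (real (n - j) + 1)) +
        1 / (2 * sqrt (real n + 1)) * (real (n choose j) * b ^ (n - j)))"
    proof (rule sum_mono)
      fix j
      have "real (n choose j) * b ^ (n - j) * (1 / sqrt (real (n - j) + 1)) \<le>
        real (n choose j) * b ^ (n - j) *
          ((sqrt (real n + 1) / (real (n - j) + 1) + 1 / sqrt (real n + 1)) / 2)"
        using b by (intro mult_left_mono inverse_sqrt_le) auto
      also have "\<dots> = sqrt (real n + 1) / 2 *
          (real (n choose j) * b ^ (n - j) / (real (n - j) + 1)) +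
        1 / (2 * sqrt (real n + 1)) * (real (n choose j) * b ^ (n - j))"
        by (simp only: distrib_left add_divide_distrib times_divide_eq_left times_divide_eq_right
          mult_1_right mult_1_left mult_ac divide_divide_eq_left)
      finally show "real (n choose j) * b ^ (n - j) / sqrt (real (n - j) + 1) \<le> \<dots>" by simp
    qed
    also have "\<dots> = sqrt (real n + 1) / 2 *
          (\<Sum>j\<le>n. real (n choose j) * b ^ (n - j) / (real (n - j) + 1)) +
        1 / (2 * sqrt (real n + 1)) * (\<Sum>j\<le>n. real (n choose j) * b ^ (n - j))"
      by (simp only: sum.distrib sum_distrib_left)
    also have "(\<Sum>j\<le>n. real (n choose j) * b ^ (n - j)) = (b + 1) ^ n"
      using binomial_ring[of 1 b n] by (simp add: add.commute)
    also have "sqrt (real n + 1) / 2 *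
          (\<Sum>j\<le>n. real (n choose j) * b ^ (n - j) / (real (n - j) + 1)) \<le>
        sqrt (real n + 1) / 2 * ((b + 1) ^ Suc n / (b * (real n + 1)))"
      using b by (intro mult_left_mono sum_binomial_div_Suc_le) auto
    also have "\<dots> = (1 + 1 / b) / 2 * ((b + 1) ^ n / sqrt (real n + 1))"
    proof -
      define s where "s = sqrt (real n + 1)"
      have s: "s > 0" "real n + 1 = s * s" by (auto simp: s_def)
      show ?thesis using b s(1) by (simp add: s(2) flip: s_def) (simp add: field_simps)
    qed
    \<comment> \<open>As \<open>b \<ge> 2\<close>, the factor \<open>(1 + 1 / b) / 2\<close> is at
      most \<open>3 / 4\<close>; the other summand carries \<open>1 / 2\<close>, and together they
      give \<open>5 / 4\<close>.\<close>
    also have "\<dots> \<le> 3 / 4 * ((b + 1) ^ n / sqrt (real n + 1))"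
      using b by (intro mult_right_mono) (auto simp: field_simps)
    finally have "real (n choose k) * real h ^ k * real (h + e) ^ (n - k) \<le>
      3 / 4 * ((b + 1) ^ n / sqrt (real n + 1)) + 1 / (2 * sqrt (real n + 1)) * (b + 1) ^ n"
      by simp
    also have "\<dots> = 5 / 4 * real (2 * h + e) ^ n / sqrt (real n + 1)"
      by (simp add: b_def e add.commute)
    finally show ?thesis .
  qed
qed

lemma card_layer_le:
  "card {x \<in> {1..n} \<rightarrow>\<^sub>E {1..q}. card {i \<in> {1..n}. x i \<le> h} = k} \<le>
    (n choose k) * h ^ k * (q - h) ^ (n - k)"
proof -
  define F where "F S = PiE {1..n} (\<lambda>i. if i \<in> S then {1..h} else {h+1..q})" for S :: "nat set"
  define SS where "SS = {S. S \<subseteq> {1..n} \<and> card S = k}"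
  have finSS: "finite SS" unfolding SS_def by (rule finite_subset[of _ "Pow {1..n}"]) auto
  have finF: "finite (F S)" for S unfolding F_def by (intro finite_PiE) auto
  have "{x \<in> {1..n} \<rightarrow>\<^sub>E {1..q}. card {i \<in> {1..n}. x i \<le> h} = k} \<subseteq> (\<Union>S\<in>SS. F S)"
  proof
    fix x assume x: "x \<in> {x \<in> {1..n} \<rightarrow>\<^sub>E {1..q}. card {i \<in> {1..n}. x i \<le> h} = k}"
    have "{i \<in> {1..n}. x i \<le> h} \<in> SS" using x by (auto simp: SS_def)
    moreover have "x \<in> F {i \<in> {1..n}. x i \<le> h}"
      using x unfolding F_def PiE_iff by auto
    ultimately show "x \<in> (\<Union>S\<in>SS. F S)" by (rule UN_I)
  qed
  then have "card {x \<in> {1..n} \<rightarrow>\<^sub>E {1..q}. card {i \<in> {1..n}. x i \<le> h} = k} \<le> card (\<Union>S\<in>SS. F S)"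
    using finSS finF by (intro card_mono) auto
  also have "\<dots> \<le> (\<Sum>S\<in>SS. card (F S))" using finSS by (rule card_UN_le)
  also have "\<dots> = (\<Sum>S\<in>SS. h ^ k * (q - h) ^ (n - k))"
  proof (rule sum.cong)
    fix S assume S: "S \<in> SS"
    have "card (F S) = (\<Prod>i\<in>{1..n}. if i \<in> S then h else q - h)"
      unfolding F_def by (subst card_PiE) (auto intro!: prod.cong)
    also have "\<dots> = h ^ card ({1..n} \<inter> S) * (q - h) ^ card ({1..n} \<inter> - S)"
      by (simp add: prod.If_cases)
    also have "{1..n} \<inter> S = S" using S by (auto simp: SS_def)
    also have "{1..n} \<inter> - S = {1..n} - S" by auto
    also have "card ({1..n} - S) = n - k"
      using S finite_subset[of S "{1..n}"] by (simp add: card_Diff_subset SS_def)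
    also have "card S = k" using S by (simp add: SS_def)
    finally show "card (F S) = h ^ k * (q - h) ^ (n - k)" .
  qed simp
  also have "\<dots> = (n choose k) * h ^ k * (q - h) ^ (n - k)"
    using n_subsets[of "{1..n}" k] by (simp add: SS_def)
  finally show ?thesis .
qed

lemma card_weight_layer_le:
  assumes "2 \<le> q"
  shows "real (card {x \<in> {1..n} \<rightarrow>\<^sub>E {1..q}. card {i \<in> {1..n}. x i \<le> q div 2} = k}) \<le>
    5 / 4 * real q ^ n / sqrt (real n + 1)"
proof -
  define h e where "h = q div 2" and "e = q mod 2"
  have q: "q = 2 * h + e" "q - h = h + e" unfolding h_def e_def by presburger+
  have "real (card {x \<in> {1..n} \<rightarrow>\<^sub>E {1..q}. card {i \<in> {1..n}. x i \<le> h} = k}) \<le>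
      real ((n choose k) * h ^ k * (q - h) ^ (n - k))"
    by (intro of_nat_mono card_layer_le)
  also have "\<dots> = real (n choose k) * real h ^ k * real (h + e) ^ (n - k)"
    by (simp add: q(2))
  also have "\<dots> \<le> 5 / 4 * real (2 * h + e) ^ n / sqrt (real n + 1)"
    using assms by (intro layer_size_le) (auto simp: h_def e_def)
  finally show ?thesis unfolding q(1)[symmetric] unfolding h_def .
qed

subsection \<open>Balanced separators from tree decompositions\<close>

lemma connected_crossing_arc:
  assumes "Digraph_Component.connected G" "a \<in> verts G" "b \<in> verts G" "a \<in> Y" "b \<notin> Y"
  obtains x y where "x \<in> verts G" "y \<in> verts G" "x \<in> Y" "y \<notin> Y"
    "(x, y) \<in> arcs_ends G \<or> (y, x) \<in> arcs_ends G"
proof -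
  have "(a, b) \<in> rtrancl_on (verts G) ((arcs_ends G)\<^sup>s)"
    using assms by (simp add: connected_conv)
  then have "b \<in> Y \<or> (\<exists>x y. x \<in> verts G \<and> y \<in> verts G \<and> x \<in> Y \<and> y \<notin> Y \<and> (x, y) \<in> (arcs_ends G)\<^sup>s)"
    by (induction rule: rtrancl_on_induct) (use assms in blast)+
  then obtain x y where "x \<in> verts G" "y \<in> verts G" "x \<in> Y" "y \<notin> Y" "(x, y) \<in> (arcs_ends G)\<^sup>s"
    using assms by blast
  then show thesis using that by (auto simp: symcl_def)
qed

section \<open>Rooting an undirected tree\<close>

context pair_graph
begin

text \<open>The distinctness of \<open>u\<close> and \<open>v\<close> makes \<open>q\<close>
  nonempty, so with the two arcs at \<open>w\<close> the cycle has length at least 3 and is not a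
  mere walk along an edge and back.\<close>

lemma cycle_of_apath:
  assumes q: "apath u q v" and ne: "u \<noteq> v" and w: "w \<notin> set (pawalk_verts u q)"
    and arcs: "(w, u) \<in> parcs G" "(v, w) \<in> parcs G"
  obtains c where "cycle c" "3 \<le> length c"
proof
  have aw: "awalk u q v" and d: "distinct (pawalk_verts u q)" using q by (auto simp: apath_def)
  have "awalk v [(v, w)] w" using arcs by (auto simp: awalk_simps intro: in_arcsD2)
  with aw have aw': "awalk u (q @ [(v, w)]) w" by (rule awalk_appendI)
  have "pawalk_verts u (q @ [(v, w)]) = pawalk_verts u q @ [w]"
    using awalk_verts_append[OF aw'] aw by simp
  moreover have "awalk w ((w, u) # q @ [(v, w)]) w"
    using aw' arcs unfolding awalk_Cons_iff[of w "(w, u)"] by simp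
  ultimately show "cycle ((w, u) # q @ [(v, w)])"
    using d w unfolding cycle_def by (intro exI[of _ w]) simp
  have "q \<noteq> []" using q ne by (auto simp: apath_Nil_iff)
  then show "3 \<le> length ((w, u) # q @ [(v, w)])" by (cases q) auto
qed

text \<open>
  A partial rooted tree: \<open>p\<close> is the parent function, \<open>d\<close> the depth; the paths inside \<open>P\<close> serve to
  close a cycle in case a new vertex has two neighbours in \<open>P\<close>.
\<close>

definition rooted_at :: "'a \<Rightarrow> 'a set \<Rightarrow> ('a \<Rightarrow> 'a) \<Rightarrow> ('a \<Rightarrow> nat) \<Rightarrow> bool" where
  "rooted_at r P p d \<longleftrightarrow> r \<in> P \<and> P \<subseteq> pverts G \<and>
    (\<forall>x\<in>P - {r}. p x \<in> P \<and> d (p x) < d x) \<and>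
    (\<forall>x\<in>P. \<forall>y\<in>P. (x, y) \<in> parcs G \<longrightarrow> x \<noteq> r \<and> y = p x \<or> y \<noteq> r \<and> x = p y) \<and>
    (\<forall>x\<in>P. \<forall>y\<in>P. \<exists>q. apath x q y \<and> set (pawalk_verts x q) \<subseteq> P)"

lemma rooted_at_insert:
  assumes acyclic: "\<not> (\<exists>c. cycle c \<and> 3 \<le> length c)" and P: "rooted_at r P p d"
    and x: "x \<in> P" and y: "y \<in> pverts G" "y \<notin> P" and xy: "(x, y) \<in> parcs G"
  shows "rooted_at r (insert y P) (p(y := x)) (d(y := Suc (d x)))"
proof -
  have yx: "(y, x) \<in> parcs G" using xy by (rule arcs_symmetric)
  have r: "r \<in> P" "y \<noteq> r" "P \<subseteq> pverts G" using P y by (auto simp: rooted_at_def)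
  have par: "\<And>z. z \<in> P \<Longrightarrow> z \<noteq> r \<Longrightarrow> p z \<in> P \<and> d (p z) < d z"
    and arc: "\<And>z w. z \<in> P \<Longrightarrow> w \<in> P \<Longrightarrow> (z, w) \<in> parcs G \<Longrightarrow> z \<noteq> r \<and> w = p z \<or> w \<noteq> r \<and> z = p w"
    and path: "\<And>z w. z \<in> P \<Longrightarrow> w \<in> P \<Longrightarrow> \<exists>q. apath z q w \<and> set (pawalk_verts z q) \<subseteq> P"
    using P unfolding rooted_at_def by blast+
  \<comment> \<open>The new vertex \<open>y\<close> must be a leaf: a second neighbour
    \<open>z\<close> in \<open>P\<close> would close a cycle through \<open>y\<close>, since the
    path from \<open>x\<close> to \<open>z\<close> inside \<open>P\<close> avoids
    \<open>y\<close>.\<close>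
  have only: "z = x" if z: "z \<in> P" "(z, y) \<in> parcs G" for z
  proof (rule ccontr)
    assume "z \<noteq> x"
    moreover obtain q where "apath x q z" "set (pawalk_verts x q) \<subseteq> P" using path x z by blast
    ultimately show False
      using cycle_of_apath[of x q z y] acyclic y z yx by blast
  qed
  have to_y: "\<exists>q. apath y q z \<and> set (pawalk_verts y q) \<subseteq> insert y P" if z: "z \<in> P" for z
  proof -
    obtain q where q: "apath x q z" "set (pawalk_verts x q) \<subseteq> P" using path x z by blast
    then have "apath y ((y, x) # q) z" using yx y by (auto simp: apath_Cons_iff)
    then show ?thesis using q by (intro exI[of _ "(y, x) # q"]) auto
  qed
  have from_y: "\<exists>q. apath z q y \<and> set (pawalk_verts z q) \<subseteq> insert y P" if z: "z \<in> P" for z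
  proof -
    obtain q where q: "apath y q z" "set (pawalk_verts y q) \<subseteq> insert y P" using to_y[OF z] by blast
    then have "set (pawalk_verts z (rev_path q)) = set (pawalk_verts y q)"
      by (subst awalk_verts_rev_path) (auto simp: apath_def)
    then show ?thesis using q by (intro exI[of _ "rev_path q"]) simp
  qed
  have refl: "\<exists>q. apath y q y \<and> set (pawalk_verts y q) \<subseteq> insert y P"
    using y by (intro exI[of _ "[]"]) (simp add: apath_Nil_iff)
  have noloop: "(y, y) \<notin> parcs G" using no_loops' by blast
  show ?thesis
    unfolding rooted_at_def
  proof (intro conjI ballI impI)
    show "r \<in> insert y P" "insert y P \<subseteq> pverts G" using r y by auto
  next
    fix z assume z: "z \<in> insert y P - {r}"
    show "(p(y := x)) z \<in> insert y P" using z par x by auto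
    show "(d(y := Suc (d x))) ((p(y := x)) z) < (d(y := Suc (d x))) z"
    proof (cases "z = y")
      case True
      then show ?thesis using x y by auto
    next
      case False
      then have "p z \<in> P" "d (p z) < d z" using z par by auto
      then show ?thesis using False y by auto
    qed
  next
    fix z w assume zw: "z \<in> insert y P" "w \<in> insert y P" "(z, w) \<in> parcs G"
    show "z \<noteq> r \<and> w = (p(y := x)) z \<or> w \<noteq> r \<and> z = (p(y := x)) w"
    proof (cases "z = y")
      case True
      then have "w \<noteq> y" using noloop zw by auto
      then have "w = x" using only[of w] zw True arcs_symmetric[of z w] by auto
      then show ?thesis using True r by simp
    next
      case z: False
      show ?thesis
      proof (cases "w = y")
        case True
        then show ?thesis using only[of z] zw z r by simp
      next
        case False
        then show ?thesis using arc[of z w] zw z by auto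
      qed
    qed
  next
    fix z w assume "z \<in> insert y P" "w \<in> insert y P"
    then show "\<exists>q. apath z q w \<and> set (pawalk_verts z q) \<subseteq> insert y P"
      using to_y from_y refl path[of z w] by blast
  qed
qed

text \<open>Starting from the root, connectedness supplies an arc leaving \<open>P\<close> as long
  as \<open>P\<close> is not everything, and its outer end is attached as a new leaf.\<close>

lemma ex_rooted_at:
  assumes conn: "Digraph_Component.connected (with_proj G)"
    and acyclic: "\<not> (\<exists>c. cycle c \<and> 3 \<le> length c)" and r: "r \<in> pverts G"
  shows "\<exists>p d. rooted_at r (pverts G) p d"
proof -
  have "\<exists>P p d. rooted_at r P p d \<and> card P = Suc k" if "Suc k \<le> card (pverts G)" for k
    using that
  proof (induction k)
    case 0
    have "rooted_at r {r} p d" for p d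
      using r no_loops' unfolding rooted_at_def
      by (auto simp: apath_Nil_iff intro!: exI[of _ "[]"])
    then show ?case by (intro exI[of _ "{r}"]) auto
  next
    case (Suc k)
    then obtain P p d where P: "rooted_at r P p d" "card P = Suc k" by auto
    then have sub: "P \<subseteq> pverts G" and "r \<in> P" by (auto simp: rooted_at_def)
    then obtain z where "z \<in> pverts G" "z \<notin> P"
      using Suc.prems P by (metis Suc_n_not_le_n subsetI subset_antisym)
    then obtain x y where xy: "x \<in> P" "y \<notin> P" "(x, y) \<in> parcs G \<or> (y, x) \<in> parcs G" "y \<in> pverts G"
      using connected_crossing_arc[OF conn, of r z P] r \<open>r \<in> P\<close> unfolding with_proj_simps by metis
    then have "(x, y) \<in> parcs G" using arcs_symmetric by blast
    then have "rooted_at r (insert y P) (p(y := x)) (d(y := Suc (d x)))"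
      using rooted_at_insert[OF acyclic P(1)] xy by blast
    moreover have "card (insert y P) = Suc (Suc k)"
      using P xy finite_subset[OF sub pair_finite_verts] by simp
    ultimately show ?case by blast
  qed
  moreover have "card (pverts G) \<noteq> 0" using r pair_finite_verts by auto
  ultimately obtain P p d where "rooted_at r P p d" "card P = card (pverts G)"
    by (metis Suc_le_eq le_refl not0_implies_Suc)
  then show ?thesis
    using card_subset_eq[OF pair_finite_verts, of P] unfolding rooted_at_def by metis
qed

end

text \<open>
  The separator is the bag of a deepest node \<open>j\<close> whose subtree covers a third of the vertices; the
  side \<open>A\<close> collects just enough of the branches below \<open>j\<close>.
\<close>

lemma tree_decomposition_separator:
  assumes td: "tree_decomposition T B G" and G: "pair_graph G"
  obtains j A C where "j \<in> pverts T" "A \<subseteq> pverts G" "C \<subseteq> pverts G"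
    "\<And>x y. x \<in> A \<Longrightarrow> y \<in> C \<Longrightarrow> x \<noteq> y \<and> (x, y) \<notin> parcs G"
    "card (pverts G) \<le> card A + card C + card (B j)"
    "card (pverts G) \<le> 3 * (card A + card (B j))"
    "card (pverts G) \<le> 3 * (card C + card (B j))"
proof -
  interpret G: pair_graph G by fact
  let ?V = "pverts G"
  define N where "N = card ?V"
  have ut: "undirected_tree T" and cover: "(\<Union>i\<in>pverts T. B i) = ?V"
    and edge: "\<And>u v. (u, v) \<in> parcs G \<Longrightarrow> \<exists>i\<in>pverts T. u \<in> B i \<and> v \<in> B i"
    and conn: "\<And>v. v \<in> ?V \<Longrightarrow>
      Digraph_Component.connected (with_proj T \<restriction> {i \<in> pverts T. v \<in> B i})"
    using td unfolding tree_decomposition_def by blast+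
  interpret T: pair_graph T using ut by (simp add: undirected_tree_def)
  have finT: "finite (pverts T)" by (rule T.pair_finite_verts)
  have finV: "finite ?V" by (rule G.pair_finite_verts)
  have Tconn: "Digraph_Component.connected (with_proj T)"
    and acyclic: "\<not> (\<exists>c. T.cycle c \<and> 3 \<le> length c)" using ut by (auto simp: undirected_tree_def)
  obtain r where r: "r \<in> pverts T"
    using Tconn by (auto simp: connected_conv)
  obtain p d where "T.rooted_at r (pverts T) p d"
    using T.ex_rooted_at[OF Tconn acyclic r] by blast
  then have p: "\<And>x. x \<in> pverts T \<Longrightarrow> x \<noteq> r \<Longrightarrow> p x \<in> pverts T"
    and d: "\<And>x. x \<in> pverts T \<Longrightarrow> x \<noteq> r \<Longrightarrow> d (p x) < d x"
    and arc: "\<And>x y. (x, y) \<in> parcs T \<Longrightarrow> x \<noteq> r \<and> y = p x \<or> y \<noteq> r \<and> x = p y"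
    unfolding T.rooted_at_def using T.in_arcsD1 T.in_arcsD2 by blast+
  \<comment> \<open>\<open>R\<close> leads from child to parent, \<open>D k\<close> is the subtree
    below \<open>k\<close> including \<open>k\<close>, \<open>W k\<close> the graph vertices covered
    by that subtree, and \<open>ch j\<close> the children of \<open>j\<close>.\<close>
  define R where "R = {(x, p x) | x. x \<in> pverts T \<and> x \<noteq> r}"
  define D where "D k = {i \<in> pverts T. (i, k) \<in> R\<^sup>*}" for k
  define W where "W k = (\<Union>i\<in>D k. B i)" for k
  define ch where "ch j = {k \<in> pverts T. k \<noteq> r \<and> p k = j}" for j
  have Dup: "p x \<in> D k" if x: "x \<in> D k" "x \<noteq> k" "x \<noteq> r" for x k
  proof -
    have "(x, k) \<in> R\<^sup>*" using x by (simp add: D_def)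
    then obtain z where "(x, z) \<in> R" "(z, k) \<in> R\<^sup>*" using x(2) by (meson converse_rtranclE)
    then show ?thesis using p by (auto simp: R_def D_def)
  qed
  have Ddown: "x \<in> D k" if "x \<in> pverts T" "x \<noteq> r" "p x \<in> D k" for x k
    using that by (auto simp: D_def R_def intro: converse_rtrancl_into_rtrancl)
  have Dr: "x \<in> D r" if "x \<in> pverts T" for x
    using that
  proof (induction "d x" arbitrary: x rule: less_induct)
    case less
    show ?case
    proof (cases "x = r")
      case True
      then show ?thesis using r by (simp add: D_def)
    next
      case False
      then show ?thesis using less p d Ddown by blast
    qed
  qed
  have Dch: "D j \<subseteq> insert j (\<Union>k\<in>ch j. D k)" for j
  proof
    fix i assume i: "i \<in> D j"
    then have "(i, j) \<in> R\<^sup>*" by (simp add: D_def)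
    then show "i \<in> insert j (\<Union>k\<in>ch j. D k)"
    proof (cases rule: rtranclE)
      case (step k)
      then have "k \<in> ch j" by (auto simp: R_def ch_def)
      moreover have "i \<in> D k" using i step by (simp add: D_def)
      ultimately show ?thesis by blast
    qed auto
  qed
  have Bsub: "B i \<subseteq> ?V" if "i \<in> pverts T" for i using that cover by blast
  have Wsub: "W k \<subseteq> ?V" for k using Bsub by (auto simp: W_def D_def)
  \<comment> \<open>The nodes whose bags contain \<open>x\<close> are connected and lie both inside
    and outside \<open>D k\<close>. The only edge leaving \<open>D k\<close> joins \<open>k\<close>
    to \<open>p k\<close>, so \<open>p k\<close> is among these nodes.\<close>
  have escape: "x \<in> B (p k)" if x: "x \<in> W k" "x \<in> B i" "i \<in> pverts T" "i \<notin> D k" for x i k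
  proof -
    let ?X = "{i \<in> pverts T. x \<in> B i}"
    obtain l where l: "l \<in> D k" "x \<in> B l" using x by (auto simp: W_def)
    have "x \<in> ?V" using x Bsub by blast
    from conn[OF this] obtain u v where uv: "u \<in> ?X" "v \<in> ?X" "u \<in> D k" "v \<notin> D k"
        "(u, v) \<in> arcs_ends (with_proj T \<restriction> ?X) \<or> (v, u) \<in> arcs_ends (with_proj T \<restriction> ?X)"
      using x l by (elim connected_crossing_arc[of _ l i "D k"]) (auto simp: D_def)
    then have "(u, v) \<in> parcs T \<or> (v, u) \<in> parcs T" by (auto simp: arcs_ends_conv)
    then have "u \<noteq> r \<and> v = p u \<or> v \<noteq> r \<and> u = p v" using arc by blast
    then show ?thesis
    proof
      assume "u \<noteq> r \<and> v = p u"
      then show ?thesis using Dup[of u k] uv by auto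
    next
      assume "v \<noteq> r \<and> u = p v"
      then show ?thesis using Ddown[of v k] uv by auto
    qed
  qed
  define big where "big = {j \<in> pverts T. N \<le> 3 * card (W j)}"
  have "D r = pverts T"
  proof
    show "D r \<subseteq> pverts T" by (auto simp: D_def)
  qed (use Dr in blast)
  then have "W r = ?V" by (simp only: W_def cover)
  then have "r \<in> big" using r by (simp add: big_def N_def)
  moreover have finbig: "finite big" using finT by (simp add: big_def)
  ultimately have "Max (d ` big) \<in> d ` big" by (intro Max_in) auto
  then obtain j where "j \<in> big" and dj: "Max (d ` big) = d j" by (rule imageE)
  moreover have "d k \<le> d j" if "k \<in> big" for k
    unfolding dj[symmetric] using that finbig by (intro Max_ge) auto
  ultimately have j: "j \<in> big" "\<And>k. k \<in> big \<Longrightarrow> d k \<le> d j" by blast+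
  have jT: "j \<in> pverts T" using j by (simp add: big_def)
  \<comment> \<open>A child of \<open>j\<close> is deeper than \<open>j\<close>, so the choice of
    \<open>j\<close> keeps it out of \<open>big\<close>.\<close>
  have small: "3 * card (W k) < N" if k: "k \<in> ch j" for k
  proof (rule ccontr)
    have "k \<in> pverts T" "d j < d k" using k d[of k] by (auto simp: ch_def)
    moreover assume "\<not> 3 * card (W k) < N"
    ultimately have "k \<in> big" "\<not> d k \<le> d j" by (simp_all add: big_def)
    then show False using j(2) by blast
  qed
  define U where "U K = B j \<union> (\<Union>k\<in>K. W k)" for K
  have Usub: "U K \<subseteq> ?V" for K using Bsub[OF jT] Wsub by (auto simp: U_def)
  define P where "P K \<longleftrightarrow> K \<subseteq> ch j \<and> N \<le> 3 * card (U K)" for K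
  have "W j \<subseteq> U (ch j)" using Dch[of j] by (fastforce simp: U_def W_def)
  then have "card (W j) \<le> card (U (ch j))"
    using finite_subset[OF Usub finV] by (intro card_mono)
  then have "P (ch j)" using j by (simp add: P_def big_def)
  \<comment> \<open>A smallest set of branches which, together with the bag of \<open>j\<close>,
    covers a third of the vertices.\<close>
  then obtain K where K: "P K" "\<And>K'. P K' \<Longrightarrow> card K \<le> card K'"
    using ex_has_least_nat[of P "ch j" card] by blast
  have Kch: "K \<subseteq> ch j" using K by (simp add: P_def)
  have "finite (ch j)" using finT by (simp add: ch_def)
  then have finK: "finite K" by (rule finite_subset[OF Kch])
  have finU: "finite (U K')" for K' using finite_subset[OF Usub finV] .
  have "card (U K) \<le> card ?V" using finV Usub by (rule card_mono)
  then have cV: "N = card (U K) + card (?V - U K)"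
    using finU Usub by (simp add: N_def card_Diff_subset)
  have third: "N \<le> 3 * (card (?V - U K) + card (B j))"
  proof (cases "K = {}")
    case True
    then show ?thesis using K by (simp add: P_def U_def)
  next
    case False
    then obtain k where k: "k \<in> K" by blast
    have "\<not> P (K - {k})"
      using K(2)[of "K - {k}"] card_Diff1_less[OF finK k] by linarith
    then have "3 * card (U (K - {k})) < N" using Kch by (auto simp: P_def)
    moreover have "3 * card (W k) < N" using small k Kch by blast
    moreover have "card (U K) \<le> card (U (K - {k})) + card (W k)"
    proof -
      have "U K \<subseteq> U (K - {k}) \<union> W k" by (auto simp: U_def)
      then have "card (U K) \<le> card (U (K - {k}) \<union> W k)"
        using finU finite_subset[OF Wsub finV] by (intro card_mono) auto
      also have "\<dots> \<le> card (U (K - {k})) + card (W k)" by (rule card_Un_le)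
      finally show ?thesis .
    qed
    ultimately have "N \<le> 3 * card (?V - U K)" using cV by linarith
    then show ?thesis by simp
  qed
  have cU: "card (U K) = card (U K - B j) + card (B j)"
  proof -
    have "B j \<subseteq> U K" by (auto simp: U_def)
    then have "card (U K - B j) = card (U K) - card (B j)" "card (B j) \<le> card (U K)"
      using finite_subset[OF _ finU] finU by (auto intro: card_Diff_subset card_mono)
    then show ?thesis by linarith
  qed
  have sep: "x \<noteq> y \<and> (x, y) \<notin> parcs G" if x: "x \<in> U K - B j" and y: "y \<in> ?V - U K" for x y
  proof
    show "x \<noteq> y" using x y by blast
    show "(x, y) \<notin> parcs G"
    proof
      assume "(x, y) \<in> parcs G"
      then obtain i where i: "i \<in> pverts T" "x \<in> B i" "y \<in> B i" using edge by blast
      obtain k where k: "k \<in> K" "x \<in> W k" using x by (auto simp: U_def)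
      \<comment> \<open>Otherwise \<open>y\<close> would lie in \<open>W k\<close>, hence in
        \<open>U K\<close>. So \<open>x\<close> also occurs outside the branch of \<open>k\<close>
        and must be in the bag of its parent \<open>j\<close>, contrary to the choice of
        \<open>x\<close>.\<close>
      have "i \<notin> D k" using i y k by (auto simp: U_def W_def)
      then have "x \<in> B (p k)" using escape k i by blast
      then show False using x k Kch by (auto simp: ch_def)
    qed
  qed
  show thesis
  proof (rule that[OF jT _ _ sep])
    show "U K - B j \<subseteq> ?V" "?V - U K \<subseteq> ?V" using Usub by blast+
    show "card ?V \<le> card (U K - B j) + card (?V - U K) + card (B j)" using cU cV N_def by linarith
    show "card ?V \<le> 3 * (card (U K - B j) + card (B j))" using K(1) cU by (simp add: P_def N_def)
    show "card ?V \<le> 3 * (card (?V - U K) + card (B j))" using third by (simp add: N_def)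
  qed
qed

subsection \<open>Path decompositions\<close>

definition path_graph :: "nat \<Rightarrow> nat pair_pre_digraph" where
  "path_graph n = \<lparr> pverts = {..n},
    parcs = {(i, j). i \<le> n \<and> j \<le> n \<and> (j = Suc i \<or> i = Suc j)} \<rparr>"

lemma pair_graph_path_graph: "pair_graph (path_graph n)"
proof -
  have "parcs (path_graph n) \<subseteq> {..n} \<times> {..n}" by (auto simp: path_graph_def)
  then have "finite (parcs (path_graph n))" by (rule finite_subset) simp
  then show ?thesis by unfold_locales (auto simp: path_graph_def symmetric_def sym_def)
qed

lemma connected_interval:
  fixes a b :: nat
  assumes "verts H = {a..b}" "a \<le> b" and arc: "\<And>i. a \<le> i \<Longrightarrow> i < b \<Longrightarrow> (i, Suc i) \<in> arcs_ends H"
  shows "Digraph_Component.connected H"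
proof -
  let ?R = "rtrancl_on {a..b} ((arcs_ends H)\<^sup>s)"
  have up: "(u, v) \<in> ?R" if "a \<le> u" "u \<le> v" "v \<le> b" for u v
    using that(2,3)
  proof (induction v rule: dec_induct)
    case base
    then show ?case using that by simp
  next
    case (step v)
    then have "(u, v) \<in> ?R" by simp
    moreover have "(v, Suc v) \<in> (arcs_ends H)\<^sup>s"
      using arc[of v] step that by (auto simp: symcl_def)
    moreover have "Suc v \<in> {a..b}" using step that by simp
    ultimately show ?case by (rule rtrancl_on_into_rtrancl_on)
  qed
  have "sym ((arcs_ends H)\<^sup>s)" by (auto simp: symcl_def sym_def)
  then have "sym ?R" by (rule rtrancl_on_sym)
  then have "(u, v) \<in> ?R" if "u \<in> {a..b}" "v \<in> {a..b}" for u v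
    using up[of u v] up[of v u] that nat_le_linear[of u v] unfolding sym_def by auto
  then show ?thesis using assms(1,2) by (simp add: connected_conv)
qed

context
  fixes n :: nat
begin

interpretation P: pair_graph "path_graph n" by (rule pair_graph_path_graph)

lemma path_graph_arc: "(i, j) \<in> parcs (path_graph n) \<Longrightarrow> j = Suc i \<or> i = Suc j"
  by (auto simp: path_graph_def)

text \<open>A discrete intermediate value property: each arc changes the node by one, so nothing in
  between is skipped.\<close>

lemma path_graph_awalk_between:
  assumes "P.awalk x p y" "a \<in> {x..y} \<union> {y..x}"
  shows "a \<in> set (pawalk_verts x p)"
  using assms
proof (induction p arbitrary: x)
  case Nil
  then show ?case by (auto simp: P.awalk_Nil_iff)
next
  case (Cons e es)
  obtain x' where e: "e = (x, x')" using Cons.prems by (cases e) (auto simp: P.awalk_Cons_iff)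
  then have "x' = Suc x \<or> x = Suc x'" and aw: "P.awalk x' es y"
    using Cons.prems path_graph_arc by (auto simp: P.awalk_Cons_iff)
  then have "a = x \<or> a \<in> {x'..y} \<union> {y..x'}" using Cons.prems(2) by auto
  then show ?case using Cons.IH[OF aw] e by auto
qed

text \<open>A path cannot pass its starting node again, so by the intermediate value property it
  runs monotonically.\<close>

lemma path_graph_apath_length:
  assumes "P.apath x p y"
  shows "y = x + length p \<or> x = y + length p"
  using assms
proof (induction p arbitrary: x)
  case Nil
  then show ?case by (simp add: P.apath_Nil_iff)
next
  case (Cons e es)
  obtain x' where e: "e = (x, x')" using Cons.prems by (cases e) (auto simp: P.apath_Cons_iff)
  then have arc: "x' = Suc x \<or> x = Suc x'" and ap: "P.apath x' es y"
      and new: "x \<notin> set (pawalk_verts x' es)"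
    using Cons.prems path_graph_arc by (auto simp: P.apath_Cons_iff)
  have "x \<notin> {x'..y} \<union> {y..x'}"
    using path_graph_awalk_between[of x' es y x] new ap by (auto simp: P.apath_def)
  then show ?case using Cons.IH[OF ap] arc by (auto simp: Suc_le_eq)
qed

lemma undirected_tree_path_graph: "undirected_tree (path_graph n)"
proof -
  \<comment> \<open>Without its first arc, a cycle is a path between adjacent nodes, hence of length
    1; all cycles just go along an edge and back.\<close>
  have "length c < 3" if c: "P.cycle c" for c
  proof -
    from c obtain u where u: "P.awalk u c u" "distinct (tl (pawalk_verts u c))" "c \<noteq> []"
      by (auto simp: P.cycle_def)
    then obtain e es where ce: "c = e # es" by (cases c) auto
    obtain v where e: "e = (u, v)" using u by (cases e) (auto simp: ce P.awalk_Cons_iff)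
    then have "v = Suc u \<or> u = Suc v" and "P.apath v es u"
      using u path_graph_arc by (auto simp: ce P.awalk_Cons_iff P.apath_def)
    then show ?thesis using path_graph_apath_length[of v es u] ce by auto
  qed
  moreover have "Digraph_Component.connected (with_proj (path_graph n))"
    by (rule connected_interval[of _ 0 n]) (auto simp: path_graph_def)
  ultimately show ?thesis
    using pair_graph_path_graph unfolding undirected_tree_def by (meson not_less)
qed

end

lemma tree_decomposition_of_weight:
  fixes w :: "'a \<Rightarrow> nat"
  assumes bound: "\<And>x. x \<in> pverts G \<Longrightarrow> w x \<le> n"
    and G: "\<And>x y. (x, y) \<in> parcs G \<Longrightarrow> x \<in> pverts G \<and> y \<in> pverts G \<and> w x \<le> w y + t \<and> w y \<le> w x + t"
  shows "tree_decomposition (path_graph n) (\<lambda>i. {x \<in> pverts G. i \<le> w x \<and> w x \<le> i + t}) G"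
  unfolding tree_decomposition_def
proof (intro conjI ballI)
  show "undirected_tree (path_graph n)" by (rule undirected_tree_path_graph)
  show "(\<Union>i\<in>pverts (path_graph n). {x \<in> pverts G. i \<le> w x \<and> w x \<le> i + t}) = pverts G"
    using bound by (force simp: path_graph_def)
next
  fix e assume e: "e \<in> parcs G"
  obtain x y where xy: "e = (x, y)" by (cases e)
  have "\<exists>i\<in>{..n}. x \<in> {x \<in> pverts G. i \<le> w x \<and> w x \<le> i + t} \<and>
      y \<in> {x \<in> pverts G. i \<le> w x \<and> w x \<le> i + t}"
    using G[of x y] bound[of x] e xy by (intro bexI[of _ "min (w x) (w y)"]) auto
  then show "case e of (u, v) \<Rightarrow> \<exists>i\<in>pverts (path_graph n).
      u \<in> {x \<in> pverts G. i \<le> w x \<and> w x \<le> i + t} \<and> v \<in> {x \<in> pverts G. i \<le> w x \<and> w x \<le> i + t}"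
    by (simp add: xy path_graph_def)
next
  fix x assume x: "x \<in> pverts G"
  \<comment> \<open>Truncated subtraction gives the right left end 0 when
    \<open>w x < t\<close>.\<close>
  have eq: "{i \<in> pverts (path_graph n). x \<in> {x \<in> pverts G. i \<le> w x \<and> w x \<le> i + t}} = {w x - t..w x}"
    using x bound[OF x] by (auto simp: path_graph_def)
  show "Digraph_Component.connected (with_proj (path_graph n) \<restriction>
      {i \<in> pverts (path_graph n). x \<in> {x \<in> pverts G. i \<le> w x \<and> w x \<le> i + t}})"
    unfolding eq using bound[OF x]
    by (intro connected_interval[of _ "w x - t" "w x"]) (auto simp: path_graph_def arcs_ends_conv image_iff)
qed

section \<open>Treewidth and bag sizes\<close>

lemma treewidth_le:
  fixes T :: "nat pair_pre_digraph"
  assumes "tree_decomposition T B G" "\<And>i. i \<in> pverts T \<Longrightarrow> real (card (B i)) \<le> c"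
  shows "real (treewidth G) \<le> c"
proof -
  have "undirected_tree T" using assms by (simp add: tree_decomposition_def)
  then interpret T: pair_graph T by (simp add: undirected_tree_def)
  have "pverts T \<noteq> {}" using \<open>undirected_tree T\<close> by (auto simp: undirected_tree_def connected_conv)
  then have "Max ((\<lambda>i. card (B i)) ` pverts T) \<in> (\<lambda>i. card (B i)) ` pverts T"
    using T.pair_finite_verts by (intro Max_in) auto
  then obtain i where i: "i \<in> pverts T" "Max ((\<lambda>i. card (B i)) ` pverts T) = card (B i)"
    by (rule imageE)
  have "treewidth G \<le> decomposition_width T B"
    unfolding treewidth_def using assms(1) by (intro Least_le) blast
  also have "\<dots> \<le> card (B i)" by (simp add: decomposition_width_def i)
  finally show ?thesis using assms(2)[OF i(1)] by linarith
qed

lemma card_bag_le_Suc_treewidth: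
  assumes "pair_graph G"
  obtains T :: "nat pair_pre_digraph" and B where "tree_decomposition T B G"
    "\<And>i. i \<in> pverts T \<Longrightarrow> card (B i) \<le> Suc (treewidth G)"
proof -
  obtain T :: "nat pair_pre_digraph" and B
    where TB: "tree_decomposition T B G" "decomposition_width T B = treewidth G"
    using treewidth_attained[OF assms] .
  then have "undirected_tree T" by (simp add: tree_decomposition_def)
  then interpret T: pair_graph T by (simp add: undirected_tree_def)
  have "card (B i) \<le> Suc (treewidth G)" if "i \<in> pverts T" for i
  proof -
    have "card (B i) \<le> Max ((\<lambda>i. card (B i)) ` pverts T)"
      using that T.pair_finite_verts by (intro Max_ge) auto
    then show ?thesis using TB(2) by (simp add: decomposition_width_def)
  qed
  then show thesis using TB(1) that by blast
qed

subsection \<open>Hamming graphs\<close>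

lemma treewidth_hamming_graph_le:
  assumes t: "1 \<le> t" and q: "2 \<le> q" and n: "1 \<le> n"
  shows "real (treewidth (hamming_graph t q n)) \<le> 5 / 2 * real t * real q ^ n / sqrt (real n)"
proof -
  let ?V = "{1..n} \<rightarrow>\<^sub>E {1..q}"
  define w :: "(nat \<Rightarrow> nat) \<Rightarrow> nat" where "w x = card {i \<in> {1..n}. x i \<le> q div 2}" for x
  define B where "B i = {x \<in> pverts (hamming_graph t q n). i \<le> w x \<and> w x \<le> i + t}" for i
  have V: "pverts (hamming_graph t q n) = ?V" by (simp add: hamming_graph_def Let_def)
  have lip: "w x \<le> w y + hamming_dist n x y" for x y
  proof -
    have "{i \<in> {1..n}. x i \<le> q div 2} \<subseteq> {i \<in> {1..n}. y i \<le> q div 2} \<union> {i \<in> {1..n}. x i \<noteq> y i}"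
      by auto
    then have "w x \<le> card ({i \<in> {1..n}. y i \<le> q div 2} \<union> {i \<in> {1..n}. x i \<noteq> y i})"
      unfolding w_def by (intro card_mono) auto
    also have "\<dots> \<le> w y + hamming_dist n x y"
      unfolding w_def hamming_dist_def by (rule card_Un_le)
    finally show ?thesis .
  qed
  have sym: "hamming_dist n x y = hamming_dist n y x" for x y
    unfolding hamming_dist_def by (rule arg_cong[where f = card]) auto
  have "w x \<le> n" for x
  proof -
    have "w x \<le> card {1..n}" unfolding w_def by (intro card_mono) auto
    then show ?thesis by simp
  qed
  moreover have "x \<in> ?V \<and> y \<in> ?V \<and> w x \<le> w y + t \<and> w y \<le> w x + t"
    if "(x, y) \<in> parcs (hamming_graph t q n)" for x y
  proof -
    have "x \<in> ?V" "y \<in> ?V" "hamming_dist n x y \<le> t"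
      using that by (simp_all add: hamming_graph_def Let_def)
    then show ?thesis using lip[of x y] lip[of y x] sym[of x y] by simp
  qed
  ultimately have "tree_decomposition (path_graph n) B (hamming_graph t q n)"
    unfolding B_def by (intro tree_decomposition_of_weight) (simp_all add: V)
  moreover have "real (card (B i)) \<le> 5 / 2 * real t * real q ^ n / sqrt (real n)" for i
  proof -
    define c where "c = 5 / 4 * real q ^ n / sqrt (real n + 1)"
    define L where "L k = {x \<in> ?V. card {i \<in> {1..n}. x i \<le> q div 2} = k}" for k
    have "finite ?V" by (intro finite_PiE) auto
    then have finL: "finite (L k)" for k by (simp add: L_def)
    have "B i \<subseteq> (\<Union>k\<in>{i..i+t}. L k)" by (auto simp: B_def L_def V w_def)
    then have "card (B i) \<le> card (\<Union>k\<in>{i..i+t}. L k)" using finL by (intro card_mono) auto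
    also have "\<dots> \<le> (\<Sum>k\<in>{i..i+t}. card (L k))" by (rule card_UN_le) simp
    finally have "real (card (B i)) \<le> (\<Sum>k\<in>{i..i+t}. real (card (L k)))"
      by (metis of_nat_mono of_nat_sum)
    also have "\<dots> \<le> (\<Sum>k\<in>{i..i+t}. c)"
      unfolding L_def c_def by (intro sum_mono card_weight_layer_le q)
    also have "\<dots> = (real t + 1) * c" by (simp add: add.commute)
    \<comment> \<open>A bag meets \<open>t + 1 \<le> 2 * t\<close> layers, which doubles
      \<open>5 / 4\<close> to \<open>5 / 2\<close>.\<close>
    also have "\<dots> \<le> (2 * real t) * (5 / 4 * real q ^ n / sqrt (real n))"
    proof (rule mult_mono)
      show "c \<le> 5 / 4 * real q ^ n / sqrt (real n)"
        unfolding c_def using n by (intro divide_left_mono) auto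
    qed (use t in \<open>auto simp: c_def\<close>)
    finally show ?thesis by simp
  qed
  ultimately show ?thesis by (rule treewidth_le)
qed

text \<open>Here \<open>n\<close> stands for the square root of the number of coordinates. A
  separator with \<open>s \<ge> N / 6\<close> is large enough because \<open>t \<le> 12 * n\<close>.
  Otherwise both sides have at least \<open>N / 6\<close> vertices, and the gap between them, of
  size at least \<open>t * (N / 6)\<^sup>2 / (2 * N * n)\<close>, lies in the separator; this is
  where 72 comes from.\<close>

lemma separator_size_ge:
  fixes a c s t n N :: real
  assumes nonneg: "0 \<le> a" "0 \<le> c" "0 \<le> t" and pos: "0 < N" "0 < n" and t: "t \<le> 12 * n"
    and third: "N \<le> 3 * (a + s)" "N \<le> 3 * (c + s)"
    and sep: "a + c + t * (a * c / (2 * N * n)) \<le> N" and cover: "N \<le> a + c + s"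
  shows "t * N / (72 * n) \<le> s"
proof (cases "N / 6 \<le> s")
  case True
  have "t * N \<le> (12 * n) * N" using t pos by (intro mult_right_mono) auto
  then have "t * N / (72 * n) \<le> N / 6" using pos by (simp add: field_simps)
  then show ?thesis using True by linarith
next
  case False
  then have ac: "N / 6 \<le> a" "N / 6 \<le> c" using third by simp_all
  have "t * N / (72 * n) = t * ((N / 6) * (N / 6) / (2 * N * n))" using pos by simp
  also have "\<dots> \<le> t * (a * c / (2 * N * n))"
    using ac nonneg pos by (intro mult_left_mono divide_right_mono mult_mono) auto
  also have "\<dots> \<le> s" using sep cover by linarith
  finally show ?thesis .
qed

lemma treewidth_hamming_graph_ge:
  assumes t: "1 \<le> t" and q: "2 \<le> q" and n: "144\<^sup>2 \<le> n" "t\<^sup>2 \<le> n"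
  shows "1 / 144 * real t * real q ^ n / sqrt (real n) \<le> real (treewidth (hamming_graph t q n))"
proof -
  let ?G = "hamming_graph t q n"
  let ?V = "{1..n} \<rightarrow>\<^sub>E {1..q}"
  define N where "N = real q ^ n"
  have V: "pverts ?G = ?V" by (simp add: hamming_graph_def Let_def)
  have "card ?V = q ^ n" by (simp add: card_PiE)
  then have cV: "real (card (pverts ?G)) = N" by (simp add: V N_def)
  obtain T :: "nat pair_pre_digraph" and B where TB: "tree_decomposition T B ?G"
      "\<And>i. i \<in> pverts T \<Longrightarrow> card (B i) \<le> Suc (treewidth ?G)"
    using card_bag_le_Suc_treewidth[OF pair_graph_hamming_graph] by blast
  obtain j A C where j: "j \<in> pverts T" and A: "A \<subseteq> ?V" and C: "C \<subseteq> ?V"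
    and sep: "\<And>x y. x \<in> A \<Longrightarrow> y \<in> C \<Longrightarrow> x \<noteq> y \<and> (x, y) \<notin> parcs ?G"
    and cover: "card (pverts ?G) \<le> card A + card C + card (B j)"
    and third: "card (pverts ?G) \<le> 3 * (card A + card (B j))"
      "card (pverts ?G) \<le> 3 * (card C + card (B j))"
    using tree_decomposition_separator[OF TB(1) pair_graph_hamming_graph] unfolding V by metis
  have far: "t < hamming_dist n x y" if "x \<in> A" "y \<in> C" for x y
  proof -
    have "x \<in> ?V" "y \<in> ?V" "x \<noteq> y" "(x, y) \<notin> parcs ?G" using sep that A C by blast+
    then show ?thesis by (simp add: hamming_graph_def Let_def)
  qed
  have n1: "n \<ge> 1" using n by simp
  have "real t \<le> sqrt (real n)"
    using n(2) by (intro real_le_rsqrt) (simp flip: of_nat_power)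
  have s144: "144 \<le> sqrt (real n)"
    using n(1) by (intro real_le_rsqrt) simp
  have N: "N > 0" using q by (simp add: N_def)
  have "real t * N / (72 * sqrt (real n)) \<le> real (card (B j))"
  proof (rule separator_size_ge)
    show "real (card A) + real (card C) +
        real t * (real (card A) * real (card C) / (2 * N * sqrt (real n))) \<le> N"
      using hamming_separation[OF n1 _ A C far] q by (simp add: N_def)
    show "N \<le> real (card A) + real (card C) + real (card (B j))"
      using cover cV by linarith
    show "N \<le> 3 * (real (card A) + real (card (B j)))" "N \<le> 3 * (real (card C) + real (card (B j)))"
      using third[THEN of_nat_mono, where 'a = real] by (simp_all add: cV)
  qed (use N n1 \<open>real t \<le> sqrt (real n)\<close> in auto)
  also have "real (card (B j)) \<le> real (treewidth ?G) + 1" using TB(2)[OF j] by linarith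
  finally have main: "real t * N / (72 * sqrt (real n)) \<le> real (treewidth ?G) + 1" .
  have "real n \<le> N"
  proof -
    have "real n \<le> 2 ^ n" using of_nat_less_two_power[of n, where ?'a = real] by linarith
    also have "\<dots> \<le> N" unfolding N_def using q by (intro power_mono) auto
    finally show ?thesis .
  qed
  \<comment> \<open>The bag size exceeds the treewidth by up to 1. Half of the main bound is at
    least 1 once \<open>sqrt n \<ge> 144\<close>; giving it up absorbs this and turns 72 into
    144.\<close>
  have "sqrt (real n) * 144 \<le> sqrt (real n) * sqrt (real n)" using s144 by (intro mult_left_mono) auto
  also have "\<dots> \<le> N" using \<open>real n \<le> N\<close> by simp
  also have "\<dots> \<le> real t * N" using t N by simp
  finally have "1 \<le> real t * N / (144 * sqrt (real n))" using n1 by (simp add: field_simps)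
  moreover have "real t * N / (72 * sqrt (real n)) = 2 * (real t * N / (144 * sqrt (real n)))" by simp
  ultimately have "real t * N / (144 * sqrt (real n)) \<le> real (treewidth ?G)" using main by linarith
  then show ?thesis by (simp add: N_def)
qed

theorem theorem1p2:
  shows "\<exists>c1 c2 :: real. 0 < c1 \<and> 0 < c2 \<and>
    (\<forall>t q :: nat. 1 \<le> t \<longrightarrow> 2 \<le> q \<longrightarrow>
      (\<exists>n0 :: nat. \<forall>n \<ge> n0.
        c1 * real t * real q ^ n / sqrt (real n) \<le> real (treewidth (hamming_graph t q n)) \<and>
        real (treewidth (hamming_graph t q n)) \<le> c2 * real t * real q ^ n / sqrt (real n)))"
proof (rule exI[of _ "1 / 144"], rule exI[of _ "5 / 2"], intro conjI allI impI)
  fix t q :: nat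
  assume t: "1 \<le> t" and q: "2 \<le> q"
  show "\<exists>n0 :: nat. \<forall>n \<ge> n0.
      1 / 144 * real t * real q ^ n / sqrt (real n) \<le> real (treewidth (hamming_graph t q n)) \<and>
      real (treewidth (hamming_graph t q n)) \<le> 5 / 2 * real t * real q ^ n / sqrt (real n)"
  \<comment> \<open>\<open>144\<^sup>2\<close> serves to absorb the 1 between bag size and
    treewidth; \<open>t\<^sup>2\<close> ensures \<open>t \<le> sqrt n\<close>, more than the
    separator estimate asks for.\<close>
  proof (intro exI[of _ "max (144\<^sup>2) (t\<^sup>2)"] allI impI)
    fix n :: nat
    assume "max (144\<^sup>2) (t\<^sup>2) \<le> n"
    then have n: "144\<^sup>2 \<le> n" "t\<^sup>2 \<le> n" by simp_all
    then have "1 \<le> n" by simp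
    then show "1 / 144 * real t * real q ^ n / sqrt (real n) \<le> real (treewidth (hamming_graph t q n)) \<and>
        real (treewidth (hamming_graph t q n)) \<le> 5 / 2 * real t * real q ^ n / sqrt (real n)"
      using treewidth_hamming_graph_ge[OF t q n] treewidth_hamming_graph_le[OF t q] by blast
  qed
qed simp_all

end
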